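(* Let $n\ge1$, $G=\mathrm{GL}(n)$ over a non-archimedean local field $F$, $K=\mathrm{GL}(n,\mathfrak{o}_F)$, and let $\mathrm{Std}:\hat G=\mathrm{GL}(n,\mathbb{C})\xrightarrow{\mathrm{id}}\mathrm{GL}(n,\mathbb{C})$ be the standard representation. Let $$\Lambda:=\left\{\sum_{i=1}^na_i\varepsilon_i\in X_*(T)_-:a_1,\ldots,a_n\ge0\right\}=\left\{\sum_{i=1}^na_i\varepsilon_i\in X_*(T):0\le a_1\le\cdots\le a_n\right\}.$$ The basic function attached to $(\mathrm{GL}(n),\mathrm{Std})$ is given by $$f_{\mathrm{Std},X}=\sum_{\mu\in\Lambda}q_F^{-\frac{n-1}{2}\det\mu}\cdot\mathbf{1}_{K\mu(\varpi)K}X^{\det\mu}.$$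
   Context: $F$ is a non-archimedean local field with ring of integers $\mathfrak{o}_F$, uniformizer $\varpi$, residue cardinality $q_F$. $G=\mathrm{GL}(n)$, $T$ the diagonal torus, $B$ the upper triangular Borel subgroup; $\varepsilon_1,\dots,\varepsilon_n$ is the standard basis of $X_*(T)$ ($\varepsilon_i$ puts $z$ in the $i$-th diagonal entry). $\det:X_*(T)\to\mathbb{Z}$, $\sum a_i\varepsilon_i\mapsto\sum a_i$. $W=\mathfrak{S}_n$ with length $\ell$. $\Sigma_B$ (resp. $\Delta_B$) denotes positive (resp. simple) roots, $X_*(T)_-=\{\mu:\langle\alpha,\mu\rangle\le0\ \forall\alpha\in\Delta_B\}$, i.e. $a_1\le\cdots\le a_n$. $\rho_{B^-}$ is the half-sum of negative roots, $\check\rho_{B^-}$ the half-sum of negative coroots. $\mu\le\lambda$ iff $\lambda-\mu$ is a $\mathbb{Z}_{\ge0}$-combination of $-\alpha^\vee$, $\alpha\in\Delta_B$. The dual group is $\hat G=\mathrm{GL}(n,\mathbb{C})$ with $X^*(\hat T)=X_*(T)$; for $\lambda\in X_*(T)_-$, $V(\lambda)$ is the irreducible representation of $\hat G$ with highest weight $\lambda$ relative to the opposite (lower triangular) Borel $\hat B^-$. Define $\mathcal{P}(\nu;q)$ by $\prod_{\alpha\in\Sigma_B}(1-qe^{-\alpha^\vee})^{-1}=\sum_\nu\mathcal{P}(\nu;q)e^\nu$ and $K_{\lambda,\mu}(q)=\sum_{w\in W}(-1)^{\ell(w)}\mathcal{P}(w(\lambda+\check\rho_{B^-})-(\mu+\check\rho_{B^-});q)$.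 For $\mu\in X_*(T)_-$, set $c_\mu(q)=\sum_{\lambda\in X_*(T)_-,\lambda\ge\mu}K_{\lambda,\mu}(q^{-1})\,\mathrm{mult}(\mathrm{Sym}^{\det\mu}(\mathrm{Std}):V(\lambda))$ if $\det\mu\ge0$ and $c_\mu(q)=0$ otherwise. The basic function is the function on $G(F)$, bi-invariant under $K$, with values in $\mathbb{C}[X]$, $$f_{\mathrm{Std},X}=\sum_{\mu\in X_*(T)_-}c_\mu(q_F)\,q_F^{-\langle\rho_{B^-},\mu\rangle}\,\mathbf{1}_{K\mu(\varpi)K}\,X^{\det\mu}.$$ $\mathbf{1}_Y$ denotes the characteristic function of $Y$. *)

theory Defs
  imports
    "Jordan_Normal_Form.Matrix"
    "HOL-Library.Poly_Mapping"
    "HOL-Combinatorics.Permutations"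
    "HOL-Computational_Algebra.Polynomial"
    "HOL-Library.Indicator_Function"
    "HOL-Library.FuncSet"
    Complex_Main
begin

section \<open>Non-archimedean local fields\<close>

text \<open>A local field is given by its normalised discrete valuation \<open>v\<close>; the value \<open>v 0\<close> (which
  should be infinite) is irrelevant.\<close>

definition frac_ideal :: "('a::field \<Rightarrow> int) \<Rightarrow> int \<Rightarrow> 'a set" where
  "frac_ideal v N = {x. x = 0 \<or> N \<le> v x}"

definition val_ring :: "('a::field \<Rightarrow> int) \<Rightarrow> 'a set" where
  "val_ring v = frac_ideal v 0"

definition residue_field :: "('a::field \<Rightarrow> int) \<Rightarrow> 'a set set" where
  "residue_field v =
     val_ring v // {(x, y). x \<in> val_ring v \<and> y \<in> val_ring v \<and> x - y \<in> frac_ideal v 1}"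

definition residue_card :: "('a::field \<Rightarrow> int) \<Rightarrow> nat" where
  "residue_card v = card (residue_field v)"

definition is_uniformizer :: "('a::field \<Rightarrow> int) \<Rightarrow> 'a \<Rightarrow> bool" where
  "is_uniformizer v x \<longleftrightarrow> x \<noteq> 0 \<and> v x = 1"

locale nonarch_local_field =
  fixes v :: "'a::field \<Rightarrow> int"
  assumes val_mult: "x \<noteq> 0 \<Longrightarrow> y \<noteq> 0 \<Longrightarrow> v (x * y) = v x + v y"
    and val_add: "x \<noteq> 0 \<Longrightarrow> y \<noteq> 0 \<Longrightarrow> x + y \<noteq> 0 \<Longrightarrow> min (v x) (v y) \<le> v (x + y)"
    and val_normalized: "\<exists>x. is_uniformizer v x"
    and complete: "\<And>s :: nat \<Rightarrow> 'a. (\<forall>N. \<exists>M. \<forall>i\<ge>M. \<forall>j\<ge>M. s i - s j \<in> frac_ideal v N) \<Longrightarrow>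
       (\<exists>l. \<forall>N. \<exists>M. \<forall>i\<ge>M. s i - l \<in> frac_ideal v N)"
    and finite_residue_field: "finite (residue_field v)"


section \<open>General linear groups over a subring\<close>

definition GL :: "nat \<Rightarrow> 'a::comm_ring_1 set \<Rightarrow> 'a mat set" where
  "GL n R = {A \<in> carrier_mat n n. elements_mat A \<subseteq> R \<and>
     (\<exists>B \<in> carrier_mat n n. elements_mat B \<subseteq> R \<and> A * B = 1\<^sub>m n \<and> B * A = 1\<^sub>m n)}"


section \<open>Cocharacters, roots and the Weyl group\<close>

text \<open>\<open>X\<^sub>*(T)\<close> and \<open>X\<^sup>*(T)\<close> are both identified with the integer vectors of dimension \<open>n\<close> via their
  standard bases; the pairing is then the scalar product.  The coroot of the root
  \<open>\<epsilon>\<^sub>i\<^sup>* - \<epsilon>\<^sub>j\<^sup>*\<close> is \<open>\<epsilon>\<^sub>i - \<epsilon>\<^sub>j\<close>, so a root and its coroot are represented by the same vector, as are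
  the half-sums of negative roots and of negative coroots.  Indices run from \<open>0\<close> to \<open>n - 1\<close>.\<close>

definition cochars :: "nat \<Rightarrow> int vec set" where
  "cochars n = carrier_vec n"

definition pos_roots :: "nat \<Rightarrow> int vec set" where
  "pos_roots n = {unit_vec n i - unit_vec n j | i j. i < j \<and> j < n}"

definition simple_roots :: "nat \<Rightarrow> int vec set" where
  "simple_roots n = {unit_vec n i - unit_vec n (Suc i) | i. Suc i < n}"

definition cochars_minus :: "nat \<Rightarrow> int vec set" where
  "cochars_minus n = {\<mu> \<in> cochars n. \<forall>\<alpha>\<in>simple_roots n. \<alpha> \<bullet> \<mu> \<le> 0}"

definition cochar_det :: "int vec \<Rightarrow> int" where
  "cochar_det \<mu> = (\<Sum>i<dim_vec \<mu>. \<mu> $ i)"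

definition cochar_le :: "nat \<Rightarrow> int vec \<Rightarrow> int vec \<Rightarrow> bool" where
  "cochar_le n \<mu> \<kappa> \<longleftrightarrow>
     (\<exists>c :: int vec \<Rightarrow> nat. \<kappa> - \<mu> = vec n (\<lambda>k. \<Sum>\<alpha>\<in>simple_roots n. int (c \<alpha>) * (- \<alpha>) $ k))"

definition rho_minus :: "nat \<Rightarrow> real vec" where
  "rho_minus n = vec n (\<lambda>k. (\<Sum>\<alpha>\<in>pos_roots n. of_int ((- \<alpha>) $ k)) / 2)"

text \<open>Coxeter length with respect to the adjacent transpositions.\<close>

definition weyl_length :: "nat \<Rightarrow> (nat \<Rightarrow> nat) \<Rightarrow> nat" where
  "weyl_length n w = (LEAST l. \<exists>is. length is = l \<and> set is \<subseteq> {i. Suc i < n} \<and>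
     w = foldr (\<circ>) (map (\<lambda>i. Transposition.transpose i (Suc i)) is) id)"

definition weyl_act :: "(nat \<Rightarrow> nat) \<Rightarrow> real vec \<Rightarrow> real vec" where
  "weyl_act w x = vec (dim_vec x) (\<lambda>k. x $ (inv_into UNIV w k))"

text \<open>The coefficient of \<open>e\<^sup>\<nu>\<close> in \<open>\<Prod>\<^sub>\<alpha> (\<Sum>\<^sub>m q\<^sup>m e\<^bsup>- m \<alpha>\<^esup>)\<close>, the product over the positive (co)roots of
  the geometric series of \<open>(1 - q e\<^bsup>-\<alpha>\<^esup>)\<^bsup>-1\<^esup>\<close>: one picks an exponent \<open>m \<alpha>\<close> from each factor.  Only
  finitely many choices contribute to a given \<open>\<nu>\<close>.  The argument is a real vector because
  \<open>\<nu> = w (\<kappa> + \<rho>) - (\<mu> + \<rho>)\<close> is formed from half-integral vectors.\<close>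

definition kostant_partition :: "nat \<Rightarrow> real vec \<Rightarrow> real \<Rightarrow> real" where
  "kostant_partition n \<nu> q =
     (\<Sum>m | m \<in> pos_roots n \<rightarrow>\<^sub>E (UNIV :: nat set) \<and>
             \<nu> = vec n (\<lambda>k. \<Sum>\<alpha>\<in>pos_roots n. of_nat (m \<alpha>) * of_int ((- \<alpha>) $ k)).
        \<Prod>\<alpha>\<in>pos_roots n. q ^ m \<alpha>)"

definition kostka_foulkes :: "nat \<Rightarrow> int vec \<Rightarrow> int vec \<Rightarrow> real \<Rightarrow> real" where
  "kostka_foulkes n \<kappa> \<mu> q =
     (\<Sum>w | w permutes {..<n}. (-1) ^ weyl_length n w *
        kostant_partition n
          (weyl_act w (map_vec of_int \<kappa> + rho_minus n) - (map_vec of_int \<mu> + rho_minus n)) q)"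


section \<open>Representations and multiplicities\<close>

text \<open>A representation of \<open>G\<close> is a subspace \<open>W\<close>, stable under \<open>G\<close>, of an ambient complex vector space
  (with scalar multiplication \<open>s\<close>) on which \<open>G\<close> acts linearly by \<open>act\<close>.\<close>

definition subrep ::
  "(complex \<Rightarrow> 'v::ab_group_add \<Rightarrow> 'v) \<Rightarrow> 'g set \<Rightarrow> ('g \<Rightarrow> 'v \<Rightarrow> 'v) \<Rightarrow> 'v set \<Rightarrow> bool" where
  "subrep s G act W \<longleftrightarrow> module.subspace s W \<and> (\<forall>g\<in>G. \<forall>w\<in>W. act g w \<in> W)"

definition irreducible_rep ::
  "(complex \<Rightarrow> 'v::ab_group_add \<Rightarrow> 'v) \<Rightarrow> 'g set \<Rightarrow> ('g \<Rightarrow> 'v \<Rightarrow> 'v) \<Rightarrow> 'v set \<Rightarrow> bool" where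
  "irreducible_rep s G act W \<longleftrightarrow> subrep s G act W \<and> W \<noteq> {0} \<and>
     (\<forall>U. subrep s G act U \<and> U \<subseteq> W \<longrightarrow> U = {0} \<or> U = W)"

definition is_direct_sum :: "'v::ab_group_add set list \<Rightarrow> 'v set \<Rightarrow> bool" where
  "is_direct_sum Ws W \<longleftrightarrow>
     W = {\<Sum>i<length Ws. x i | x. \<forall>i<length Ws. x i \<in> Ws ! i} \<and>
     (\<forall>x. (\<forall>i<length Ws. x i \<in> Ws ! i) \<and> (\<Sum>i<length Ws. x i) = 0 \<longrightarrow>
          (\<forall>i<length Ws. x i = 0))"

definition lower_borel :: "nat \<Rightarrow> complex mat set" where
  "lower_borel n = {b \<in> GL n UNIV. \<forall>i j. i < j \<and> j < n \<longrightarrow> b $$ (i, j) = 0}"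

text \<open>\<open>W\<close> contains a nonzero eigenvector of the lower triangular Borel subgroup on which it acts
  through the character \<open>\<kappa>\<close> of its diagonal torus.\<close>

definition has_highest_weight :: "nat \<Rightarrow> (complex \<Rightarrow> 'v::ab_group_add \<Rightarrow> 'v) \<Rightarrow>
    (complex mat \<Rightarrow> 'v \<Rightarrow> 'v) \<Rightarrow> int vec \<Rightarrow> 'v set \<Rightarrow> bool" where
  "has_highest_weight n s act \<kappa> W \<longleftrightarrow>
     (\<exists>x\<in>W. x \<noteq> 0 \<and> (\<forall>b\<in>lower_borel n. act b x = s (\<Prod>i<n. (b $$ (i, i)) powi (\<kappa> $ i)) x))"

text \<open>\<open>W\<close> is (a copy of) \<open>V(\<kappa>)\<close>: an algebraic irreducible representation is determined up to
  isomorphism by its highest weight.  This is only used inside the algebraic representations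
  \<open>Sym\<^sup>k(Std)\<close>, so algebraicity need not be required separately.\<close>

definition is_V :: "nat \<Rightarrow> (complex \<Rightarrow> 'v::ab_group_add \<Rightarrow> 'v) \<Rightarrow>
    (complex mat \<Rightarrow> 'v \<Rightarrow> 'v) \<Rightarrow> int vec \<Rightarrow> 'v set \<Rightarrow> bool" where
  "is_V n s act \<kappa> W \<longleftrightarrow> irreducible_rep s (GL n UNIV) act W \<and> has_highest_weight n s act \<kappa> W"

text \<open>The number of copies of \<open>V(\<kappa>)\<close> in a decomposition of a semisimple \<open>W\<close> into irreducibles (the
  number does not depend on the decomposition).\<close>

definition mult_V :: "nat \<Rightarrow> (complex \<Rightarrow> 'v::ab_group_add \<Rightarrow> 'v) \<Rightarrow>
    (complex mat \<Rightarrow> 'v \<Rightarrow> 'v) \<Rightarrow> 'v set \<Rightarrow> int vec \<Rightarrow> nat" where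
  "mult_V n s act W \<kappa> =
     (THE m. \<exists>Ws. is_direct_sum Ws W \<and> (\<forall>U\<in>set Ws. irreducible_rep s (GL n UNIV) act U) \<and>
        m = length (filter (is_V n s act \<kappa>) Ws))"


section \<open>Symmetric powers\<close>

text \<open>The symmetric algebra of \<open>\<complex>\<^sup>n\<close> is the polynomial ring in the basis vectors
  \<open>e\<^sub>0, \<dots>, e\<^bsub>n-1\<^esub>\<close> of \<open>\<complex>\<^sup>n\<close>.  Polynomials are finitely supported functions on monomials, and
  monomials are finitely supported functions on the indices of the variables.\<close>

type_synonym sym_alg = "(nat \<Rightarrow>\<^sub>0 nat) \<Rightarrow>\<^sub>0 complex"

definition sym_scale :: "complex \<Rightarrow> sym_alg \<Rightarrow> sym_alg" where
  "sym_scale c p = Poly_Mapping.map ((*) c) p"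

definition sym_var :: "nat \<Rightarrow> sym_alg" where
  "sym_var i = Poly_Mapping.single (Poly_Mapping.single i 1) 1"

definition Sym :: "nat \<Rightarrow> nat \<Rightarrow> sym_alg set" where
  "Sym n k = {p. \<forall>m\<in>Poly_Mapping.keys p. Poly_Mapping.keys m \<subseteq> {..<n} \<and>
                   (\<Sum>i\<in>Poly_Mapping.keys m. Poly_Mapping.lookup m i) = k}"

definition Std :: "complex mat \<Rightarrow> complex mat" where
  "Std = id"

text \<open>The action on the symmetric algebra induced by a linear representation \<open>r\<close> on \<open>\<complex>\<^sup>n\<close>: the algebra
  endomorphism extending \<open>e\<^sub>j \<mapsto> r(g) e\<^sub>j = \<Sum>\<^sub>i r(g)\<^sub>i\<^sub>j e\<^sub>i\<close>.\<close>

definition sym_act :: "nat \<Rightarrow> (complex mat \<Rightarrow> complex mat) \<Rightarrow> complex mat \<Rightarrow> sym_alg \<Rightarrow> sym_alg" where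
  "sym_act n r g p =
     (\<Sum>m\<in>Poly_Mapping.keys p. sym_scale (Poly_Mapping.lookup p m)
        (\<Prod>j\<in>Poly_Mapping.keys m.
           (\<Sum>i<n. sym_scale (r g $$ (i, j)) (sym_var i)) ^ Poly_Mapping.lookup m j))"

lemma lookup_sym_scale [simp]:
  "Poly_Mapping.lookup (sym_scale c p) m = c * Poly_Mapping.lookup p m"
  by (simp add: sym_scale_def Poly_Mapping.map.rep_eq when_def)

lemma vector_space_sym_scale: "vector_space sym_scale"
  by unfold_locales (auto intro!: poly_mapping_eqI simp: lookup_add algebra_simps)


section \<open>The basic function\<close>

text \<open>Both infinite sums below have finite support: for \<open>basic_coeff\<close> because a finite-dimensional
  representation has only finitely many constituents, for \<open>basic_function\<close> (at each fixed \<open>g\<close>) because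
  the double cosets of distinct \<open>\<mu>\<close> are disjoint.  If \<open>cochar_det \<mu> < 0\<close> then \<open>basic_coeff\<close> vanishes,
  so the truncation by \<open>nat\<close> in the exponent of \<open>X\<close> is harmless.\<close>

definition basic_coeff :: "nat \<Rightarrow> int vec \<Rightarrow> real \<Rightarrow> real" where
  "basic_coeff n \<mu> q =
     (if 0 \<le> cochar_det \<mu> then
        Sum_any (\<lambda>\<kappa>. (kostka_foulkes n \<kappa> \<mu> (inverse q) *
            real (mult_V n sym_scale (sym_act n Std) (Sym n (nat (cochar_det \<mu>))) \<kappa>))
          when (\<kappa> \<in> cochars_minus n \<and> cochar_le n \<mu> \<kappa>))
      else 0)"

definition cochar_eval :: "nat \<Rightarrow> int vec \<Rightarrow> 'a::field \<Rightarrow> 'a mat" where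
  "cochar_eval n \<mu> z = mat_diag n (\<lambda>i. z powi (\<mu> $ i))"

definition double_coset :: "'a::semiring_0 mat set \<Rightarrow> 'a mat \<Rightarrow> 'a mat set" where
  "double_coset K x = {k\<^sub>1 * x * k\<^sub>2 | k\<^sub>1 k\<^sub>2. k\<^sub>1 \<in> K \<and> k\<^sub>2 \<in> K}"

definition basic_function ::
  "nat \<Rightarrow> ('a::field \<Rightarrow> int) \<Rightarrow> 'a \<Rightarrow> 'a mat \<Rightarrow> complex poly" where
  "basic_function n v \<pi> g =
     Sum_any (\<lambda>\<mu>. Polynomial.monom
         (of_real (basic_coeff n \<mu> (real (residue_card v)) *
                   real (residue_card v) powr (- (rho_minus n \<bullet> map_vec of_int \<mu>))) *
          indicator (double_coset (GL n (val_ring v)) (cochar_eval n \<mu> \<pi>)) g)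
         (nat (cochar_det \<mu>))
       when \<mu> \<in> cochars_minus n)"

definition Lam :: "nat \<Rightarrow> int vec set" where
  "Lam n = {\<mu> \<in> cochars_minus n. \<forall>i<n. 0 \<le> \<mu> $ i}"

end

theory Submission
  imports Defs
begin

text \<open>\<open>Sym\<^sup>k(Std)\<close> is irreducible with highest weight \<open>\<lambda> = k \<epsilon>\<^sub>n\<close>, and \<open>\<mu> \<le> \<lambda>\<close> holds exactly for
  \<open>\<mu> \<in> \<Lambda>\<close>, so everything reduces to \<open>K\<^bsub>\<lambda>,\<mu>\<^esub>(q) = q\<^sup>N\<close> with \<open>N = \<Sum>\<^sub>i (n - i) \<mu>\<^sub>i\<close>.  In the alternating sum
  defining \<open>K\<^bsub>\<lambda>,\<mu>\<^esub>\<close> only the \<open>w\<close> fixing the last index contribute, since the last coordinate of a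
  partition into negative roots is nonnegative.  Extracting the exponents of the last variable leaves
  a sum over the compositions \<open>b\<close> of \<open>\<mu>\<^sub>1 + \<dots> + \<mu>\<^bsub>n-1\<^esub>\<close> (\<open>row_sum\<close> below).  It satisfies a recursion in
  the number of variables: expanding the factor \<open>\<Prod>\<^sub>i (x\<^sub>n - x\<^sub>i)\<close> of the Vandermonde determinant yields
  elementary symmetric functions, and these cancel the complete symmetric functions coming from \<open>b\<close>.\<close>

section \<open>Signs of Weyl group elements\<close>

text \<open>The cancellation in the signed sum is organised by shift operators: alternating a
  function over all rearrangements of \<open>0, ..., n\<close> applies the product of all
  \<open>T\<^sub>j - T\<^sub>i\<close> with \<open>i < j\<close>, and the factors involving the last
  operator are what removes one variable. Since \<lambda> has a single nonzero coordinate, fixing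
  the last index leaves a sum in which \<lambda> survives only through a total degree; this is why
  one family, \<open>row_sum\<close>, carries both the polynomial and its recursion. Irreducibility
  of the symmetric powers rests on two elements of the group: a diagonal matrix isolates single
  monomials, because distinct monomials have distinct weights, and a matrix with positive entries
  spreads one monomial over all of them, because positive coefficients cannot cancel. The shape of
  the final exponent has a simple origin: in \<open>N\<close> and in the pairing with \<rho> the
  weight of the i-th coordinate is linear in i with opposite slopes, so that only a multiple of the
  determinant remains.\<close>

definition weyl_word :: "nat list \<Rightarrow> nat \<Rightarrow> nat" where
  "weyl_word ks = foldr (\<circ>) (map (\<lambda>i. Transposition.transpose i (Suc i)) ks) id"

lemma weyl_word_Nil [simp]: "weyl_word [] = id"
  and weyl_word_Cons [simp]:
    "weyl_word (k # ks) = Transposition.transpose k (Suc k) \<circ> weyl_word ks"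
  by (simp_all only: weyl_word_def list.map foldr.simps comp_apply id_apply)

lemma weyl_word_append: "weyl_word (ks @ js) = weyl_word ks \<circ> weyl_word js"
  by (induction ks) (simp_all only: append_Nil append_Cons weyl_word_Nil weyl_word_Cons id_comp o_assoc)

lemma permutation_weyl_word: "permutation (weyl_word ks)"
  by (induction ks)
    (simp_all only: weyl_word_Nil weyl_word_Cons permutation_id permutation_compose permutation_swap_id)

lemma sign_weyl_word: "sign (weyl_word ks) = (- 1) ^ length ks"
  by (induction ks)
    (simp_all add: sign_compose permutation_weyl_word permutation_swap_id sign_swap_id del: o_apply)

text \<open>Induction on \<open>j\<close>: conjugating the transposition of \<open>i\<close> and
  \<open>j\<close> by the adjacent one of \<open>j\<close> and \<open>Suc j\<close> moves the second
  index up by one.\<close>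

lemma transpose_weyl_word:
  assumes "i < j" "j < n"
  shows "\<exists>ks. set ks \<subseteq> {i. Suc i < n} \<and> Transposition.transpose i j = weyl_word ks"
  using assms
proof (induction j)
  case (Suc j)
  show ?case
  proof (cases "i = j")
    case True
    with Suc.prems show ?thesis
      by (intro exI[of _ "[j]"]) auto
  next
    case False
    then obtain ks where ks: "set ks \<subseteq> {i. Suc i < n}" "Transposition.transpose i j = weyl_word ks"
      using Suc by (metis Suc_lessD less_antisym)
    have "Transposition.transpose i (Suc j) =
        Transposition.transpose j (Suc j) \<circ> Transposition.transpose i j \<circ> Transposition.transpose j (Suc j)"
      using False Suc.prems by (auto simp: fun_eq_iff Transposition.transpose_def)
    also have "\<dots> = weyl_word ([j] @ ks @ [j])"
      by (simp only: weyl_word_append ks(2) weyl_word_Nil weyl_word_Cons comp_id o_assoc)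
    finally show ?thesis
      using ks(1) Suc.prems by (intro exI[of _ "[j] @ ks @ [j]"]) auto
  qed
qed simp

lemma permutes_weyl_word:
  assumes "w permutes {..<n}"
  shows "\<exists>ks. set ks \<subseteq> {i. Suc i < n} \<and> w = weyl_word ks"
  using assms finite_lessThan[of n]
proof (induction rule: permutes_induct)
  case id
  show ?case by (intro exI[of _ "[]"]) auto
next
  case (swap a b p)
  obtain ks where ks: "set ks \<subseteq> {i. Suc i < n}" "p = weyl_word ks"
    using swap by blast
  obtain js where js: "set js \<subseteq> {i. Suc i < n}" "Transposition.transpose a b = weyl_word js"
  proof (cases a b rule: linorder_cases)
    case less
    with transpose_weyl_word[of a b n] swap(2) that show ?thesis
      by (metis lessThan_iff)
  next
    case greater
    with transpose_weyl_word[of b a n] swap(1) that show ?thesis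
      using transpose_commute[of a b] by (metis lessThan_iff)
  qed (use swap(3) in blast)
  show ?case
    using ks js by (intro exI[of _ "js @ ks"]) (simp add: weyl_word_append del: o_apply)
qed

text \<open>The sign records the parity of any word representing \<open>w\<close>. That some word
  exists is what makes the \<open>LEAST\<close> in \<open>weyl_length\<close> an attained
  value.\<close>

lemma minus_one_power_weyl_length:
  assumes "w permutes {..<n}"
  shows "(- 1) ^ weyl_length n w = (of_int (sign w) :: real)"
proof -
  obtain ks where "set ks \<subseteq> {i. Suc i < n}" "w = weyl_word ks"
    using permutes_weyl_word[OF assms] by blast
  then have "\<exists>ls. length ls = length ks \<and> set ls \<subseteq> {i. Suc i < n} \<and> w = weyl_word ls"
    by blast
  then have "\<exists>ls. length ls = (LEAST l. \<exists>ks. length ks = l \<and> set ks \<subseteq> {i. Suc i < n} \<and> w = weyl_word ks) \<and>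
      set ls \<subseteq> {i. Suc i < n} \<and> w = weyl_word ls"
    by (rule LeastI)
  then obtain js where "length js = weyl_length n w" "w = weyl_word js"
    by (auto simp only: weyl_length_def weyl_word_def)
  then show ?thesis
    using sign_weyl_word[of js] by simp
qed


section \<open>Alternating sums\<close>

definition shift :: "nat set \<Rightarrow> (nat \<Rightarrow> int) \<Rightarrow> nat \<Rightarrow> int" where
  "shift S x = (\<lambda>i. if i \<in> S then x i + 1 else x i)"

text \<open>The argument \<open>x\<close> is a function on all indices although only those below
  \<open>n\<close> are permuted: \<open>x n\<close> rides along as a fixed last argument of
  \<open>f\<close>, which lets sums over \<open>n\<close> and \<open>Suc n\<close> indices act on
  the same \<open>f\<close>.\<close>

definition alt_sum :: "nat \<Rightarrow> (nat \<Rightarrow> int) \<Rightarrow> ((nat \<Rightarrow> int) \<Rightarrow> real) \<Rightarrow> real" where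
  "alt_sum n x f = (\<Sum>w | w permutes {..<n}. of_int (sign w) * f (x \<circ> w))"

lemma alt_sum_permute:
  assumes "p permutes {..<n}"
  shows "alt_sum n (x \<circ> p) f = of_int (sign p) * alt_sum n x f"
proof -
  have "alt_sum n x f = (\<Sum>w | w permutes {..<n}. of_int (sign (p \<circ> w)) * f (x \<circ> (p \<circ> w)))"
    unfolding alt_sum_def by (rule setum_permutations_compose_left[OF assms])
  also have "\<dots> = (\<Sum>w | w permutes {..<n}. of_int (sign p) * (of_int (sign w) * f ((x \<circ> p) \<circ> w)))"
  proof (rule sum.cong[OF refl])
    fix w assume "w \<in> {w. w permutes {..<n}}"
    then have "permutation w" "permutation p"
      using assms permutation_permutes finite_lessThan by blast+
    then show "of_int (sign (p \<circ> w)) * f (x \<circ> (p \<circ> w)) =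
        of_int (sign p) * (of_int (sign w) * f ((x \<circ> p) \<circ> w))"
      by (simp add: sign_compose o_assoc del: o_apply)
  qed
  also have "\<dots> = of_int (sign p) * alt_sum n (x \<circ> p) f"
    by (simp only: alt_sum_def sum_distrib_left)
  finally have "of_int (sign p) * alt_sum n x f = of_int (sign p * sign p) * alt_sum n (x \<circ> p) f"
    by (simp only: of_int_mult mult.assoc)
  then show ?thesis
    by (simp only: sign_idempotent of_int_1 mult_1)
qed

lemma alt_sum_eq_0:
  assumes "i < n" "j < n" "i \<noteq> j" "x i = x j"
  shows "alt_sum n x f = 0"
proof -
  have "x \<circ> Transposition.transpose i j = x"
    using assms(4) by (auto simp: fun_eq_iff Transposition.transpose_def)
  then show ?thesis
    using alt_sum_permute[OF permutes_swap_id[of i "{..<n}" j], of x f] assms by (simp add: sign_swap_id)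
qed

text \<open>Coset decomposition: a permutation of \<open>Suc n\<close> points is, in exactly one
  way, the transposition of \<open>n\<close> with some \<open>b\<close> after a permutation fixing
  \<open>n\<close>. The case \<open>b = n\<close> is the identity and keeps its sign.\<close>

lemma alt_sum_Suc:
  "alt_sum (Suc n) x f = alt_sum n x f - (\<Sum>b<n. alt_sum n (x \<circ> Transposition.transpose n b) f)"
proof -
  have "alt_sum (Suc n) x f =
      (\<Sum>b\<in>insert n {..<n}. \<Sum>w | w permutes {..<n}.
        of_int (sign (Transposition.transpose n b \<circ> w)) * f (x \<circ> (Transposition.transpose n b \<circ> w)))"
    unfolding alt_sum_def lessThan_Suc by (rule sum_over_permutations_insert) auto
  also have "\<dots> = (\<Sum>b\<in>insert n {..<n}. (if b = n then 1 else - 1) * alt_sum n (x \<circ> Transposition.transpose n b) f)"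
  proof (rule sum.cong[OF refl])
    fix b assume "b \<in> insert n {..<n}"
    have "of_int (sign (Transposition.transpose n b \<circ> w)) * f (x \<circ> (Transposition.transpose n b \<circ> w)) =
        (if b = n then 1 else - 1) * (of_int (sign w) * f ((x \<circ> Transposition.transpose n b) \<circ> w))"
      if "w permutes {..<n}" for w
    proof -
      have "permutation w"
        using that permutation_permutes finite_lessThan by blast
      then show ?thesis
        by (simp add: sign_compose permutation_swap_id sign_swap_id o_assoc del: o_apply)
    qed
    then show "(\<Sum>w | w permutes {..<n}.
        of_int (sign (Transposition.transpose n b \<circ> w)) * f (x \<circ> (Transposition.transpose n b \<circ> w))) =
        (if b = n then 1 else - 1) * alt_sum n (x \<circ> Transposition.transpose n b) f"
      unfolding alt_sum_def sum_distrib_left by (intro sum.cong) auto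
  qed
  finally show ?thesis
    by (simp add: sum_negf)
qed

text \<open>Brings a term of \<open>alt_sum_Suc\<close> into the form in which it survives in
  \<open>alt_sum_vandermonde\<close>: the first \<open>n\<close> entries increase and omit
  \<open>d\<close>, which sits at position \<open>n\<close>. The sign counts the
  \<open>n - Suc d\<close> adjacent swaps.\<close>

lemma alt_sum_cycle:
  assumes "d < n"
  shows "alt_sum n (int \<circ> Transposition.transpose n d) f =
    (-1) ^ (n - Suc d) * alt_sum n ((shift {d..<n} int)(n := int d)) f"
proof -
  define u where "u j = (\<lambda>i. if i = n then int d else if i = j then int n else
      if j < i \<and> i < n then int i else if d \<le> i \<and> i < j then int i + 1 else int i)" for j
  \<comment> \<open>the entry \<open>n\<close> travels from position \<open>d\<close> to position \<open>n - 1\<close>\<close>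
  have "alt_sum n (u d) f = (-1) ^ (j - d) * alt_sum n (u j) f" if "d \<le> j" "j < n" for j
    using that
  proof (induction j rule: dec_induct)
    case (step j)
    have "u (Suc j) = u j \<circ> Transposition.transpose j (Suc j)"
      using step by (auto simp: u_def fun_eq_iff Transposition.transpose_def)
    then have "alt_sum n (u (Suc j)) f = - alt_sum n (u j) f"
      using step alt_sum_permute[OF permutes_swap_id[of j "{..<n}" "Suc j"], of "u j" f]
      by (simp add: sign_swap_id)
    with step show ?case
      by (simp add: Suc_diff_le)
  qed simp
  from this[of "n - 1"] have "alt_sum n (u d) f = (-1) ^ (n - Suc d) * alt_sum n (u (n - 1)) f"
    using assms by simp
  moreover have "u d = int \<circ> Transposition.transpose n d"
    using assms by (auto simp: u_def fun_eq_iff Transposition.transpose_def)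
  moreover have "u (n - 1) = (shift {d..<n} int)(n := int d)"
    using assms by (auto simp: u_def fun_eq_iff shift_def)
  ultimately show ?thesis
    by simp
qed

text \<open>The factor \<open>\<Prod>\<^sub>i (T\<^sub>n - T\<^sub>i)\<close> of the Vandermonde determinant, \<open>T\<^sub>i\<close> being the operator that increases
  the \<open>i\<close>-th argument of \<open>f\<close> by one.\<close>
lemma alt_sum_vandermonde:
  "alt_sum (Suc n) int f = alt_sum n int (\<lambda>x. \<Sum>S\<in>Pow {..<n}. (-1) ^ card S * f ((shift S x)(n := int n - int (card S))))"
proof -
  define F where "F S = (-1) ^ card S * alt_sum n ((shift S int)(n := int n - int (card S))) f" for S :: "nat set"
  have "alt_sum n int (\<lambda>x. \<Sum>S\<in>Pow {..<n}. (-1) ^ card S * f ((shift S x)(n := int n - int (card S)))) =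
      (\<Sum>w | w permutes {..<n}. \<Sum>S\<in>Pow {..<n}. of_int (sign w) *
        ((-1) ^ card S * f ((shift S (int \<circ> w))(n := int n - int (card S)))))"
    by (simp only: alt_sum_def sum_distrib_left)
  also have "\<dots> = (\<Sum>w | w permutes {..<n}. \<Sum>S\<in>Pow {..<n}. of_int (sign w) *
        ((-1) ^ card S * f ((shift S int)(n := int n - int (card S)) \<circ> w)))"
  proof (rule sum.cong[OF refl])
    fix w assume "w \<in> {w. w permutes {..<n}}"
    then have w: "w permutes {..<n}" by simp
    show "(\<Sum>S\<in>Pow {..<n}. of_int (sign w) *
        ((-1) ^ card S * f ((shift S (int \<circ> w))(n := int n - int (card S))))) =
      (\<Sum>S\<in>Pow {..<n}. of_int (sign w) *
        ((-1) ^ card S * f ((shift S int)(n := int n - int (card S)) \<circ> w)))"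
    proof (rule sum.reindex_bij_witness[of _ "\<lambda>S. w -` S" "\<lambda>S. w ` S"])
      fix S assume S: "S \<in> Pow {..<n}"
      show "w -` w ` S = S"
        using permutes_inj[OF w] by (simp add: inj_vimage_image_eq)
      show "w ` S \<in> Pow {..<n}"
        using permutes_image[OF w] S by blast
      show "w ` (w -` S) = S"
        using permutes_surj[OF w] by (simp add: surj_image_vimage_eq)
      show "w -` S \<in> Pow {..<n}"
        using S permutes_in_image[OF w] by auto
      have "card (w ` S) = card S"
        by (meson card_image inj_on_subset permutes_inj[OF w] subset_UNIV)
      moreover have "(shift (w ` S) int)(n := c) \<circ> w = (shift S (int \<circ> w))(n := c)" for c
      proof
        fix i
        have "w i = n \<longleftrightarrow> i = n"
          using permutes_not_in[OF w, of n] permutes_inj[OF w] by (metis injD lessThan_iff less_irrefl)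
        moreover have "w i \<in> w ` S \<longleftrightarrow> i \<in> S"
          using permutes_inj[OF w] by (auto dest: injD)
        ultimately show "((shift (w ` S) int)(n := c) \<circ> w) i = ((shift S (int \<circ> w))(n := c)) i"
          by (simp add: shift_def)
      qed
      ultimately show "of_int (sign w) *
          ((-1) ^ card (w ` S) * f ((shift (w ` S) int)(n := int n - int (card (w ` S))) \<circ> w)) =
        of_int (sign w) * ((-1) ^ card S * f ((shift S (int \<circ> w))(n := int n - int (card S))))"
        by (simp del: o_apply)
    qed
  qed
  also have "\<dots> = (\<Sum>S\<in>Pow {..<n}. F S)"
    by (subst sum.swap) (simp add: F_def alt_sum_def sum_distrib_left mult_ac del: o_apply)
  \<comment> \<open>If \<open>i\<close> lies in \<open>S\<close> but \<open>Suc i < n\<close> does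
    not, positions \<open>i\<close> and \<open>Suc i\<close> of the shifted tuple both hold
    \<open>Suc i\<close> and the alternating sum vanishes. What survives are the upper intervals,
    with \<open>d = n\<close> for the empty set.\<close>
  also have "\<dots> = (\<Sum>S\<in>(\<lambda>d. {d..<n}) ` {..n}. F S)"
  proof (rule sum.mono_neutral_right)
    show "(\<lambda>d. {d..<n}) ` {..n} \<subseteq> Pow {..<n}"
      by auto
    show "\<forall>S\<in>Pow {..<n} - (\<lambda>d. {d..<n}) ` {..n}. F S = 0"
    proof
      fix S assume S: "S \<in> Pow {..<n} - (\<lambda>d. {d..<n}) ` {..n}"
      have "S \<noteq> {}"
        using S by (auto simp: image_def)
      then obtain m where m: "m \<in> S" "\<forall>i\<in>S. m \<le> i"
        using LeastI_ex[of "\<lambda>i. i \<in> S"] Least_le[of "\<lambda>i. i \<in> S"] by blast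
      have "m \<le> n"
        using S m(1) by auto
      then have "S \<noteq> {m..<n}" "S \<subseteq> {m..<n}"
        using S m by (blast, auto)
      then obtain j where j: "m \<le> j" "j < n" "j \<notin> S"
        by (metis atLeastLessThan_iff subsetI subset_antisym)
      have "\<exists>i. i \<in> S \<and> Suc i \<notin> S \<and> Suc i < n"
      proof (rule ccontr)
        assume *: "\<not> ?thesis"
        have "i \<in> S" if "m \<le> i" "i < n" for i
          using that
        proof (induction i rule: dec_induct)
          case (step i)
          with * show ?case by auto
        qed (use m(1) in simp)
        with j show False by blast
      qed
      then obtain i where "i \<in> S" "Suc i \<notin> S" "Suc i < n"
        by blast
      then show "F S = 0"
        unfolding F_def by (subst alt_sum_eq_0[of i n "Suc i"]) (auto simp: shift_def)
    qed
  qed simp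
  also have "\<dots> = (\<Sum>d\<le>n. F {d..<n})"
  proof (subst sum.reindex)
    have "d = n - card {d..<n}" if "d \<le> n" for d
      using that by simp
    then show "inj_on (\<lambda>d. {d..<n}) {..n}"
      by (metis (no_types, lifting) atMost_iff inj_onI)
  qed simp
  also have "\<dots> = alt_sum n int f - (\<Sum>b<n. alt_sum n (int \<circ> Transposition.transpose n b) f)"
  proof -
    have "F {n..<n} = alt_sum n int f"
      by (simp add: F_def shift_def fun_upd_idem)
    moreover have "F {d..<n} = - alt_sum n (int \<circ> Transposition.transpose n d) f" if "d < n" for d
    proof -
      \<comment> \<open>The interval has one element more than the cycle has swaps; this extra sign
        is the minus sign in \<open>alt_sum_Suc\<close>.\<close>
      have "n - d = Suc (n - Suc d)"
        using that by simp
      then have "(-1) ^ (n - d) = - ((-1) ^ (n - Suc d) :: real)"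
        by simp
      with that show ?thesis
        by (simp add: F_def alt_sum_cycle of_nat_diff del: o_apply)
    qed
    ultimately show ?thesis
      by (simp add: lessThan_Suc_atMost[symmetric] sum_negf del: o_apply)
  qed
  also have "\<dots> = alt_sum (Suc n) int f"
    by (rule alt_sum_Suc[symmetric])
  finally show ?thesis by simp
qed


section \<open>Kostka--Foulkes polynomials of one-row shapes\<close>

text \<open>The value 0 beyond \<open>n\<close> makes a composition a unique function, so the set is
  finite. The total is an integer because negative totals do occur below; they give the empty
  set.\<close>

definition comps :: "nat \<Rightarrow> int \<Rightarrow> (nat \<Rightarrow> nat) set" where
  "comps n s = {c. (\<forall>i\<ge>n. c i = 0) \<and> (\<Sum>i<n. int (c i)) = s}"

lemma finite_comps: "finite (comps n s)"
proof (rule finite_subset)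
  have "c i \<le> nat s" if "c \<in> comps n s" for c i
  proof (cases "i < n")
    case True
    then have "int (c i) \<le> (\<Sum>i<n. int (c i))"
      by (intro member_le_sum) auto
    with that show ?thesis
      by (auto simp: comps_def)
  qed (use that in \<open>auto simp: comps_def\<close>)
  then show "comps n s \<subseteq> {c. \<forall>i. (i \<in> {..<n} \<longrightarrow> c i \<in> {..nat s}) \<and> (i \<notin> {..<n} \<longrightarrow> c i = 0)}"
    by (auto simp: comps_def)
qed (intro finite_set_of_finite_funs; simp)

lemma comps_neg: "s < 0 \<Longrightarrow> comps n s = {}"
  unfolding comps_def by (auto, metis leD of_nat_0_le_iff sum_nonneg)

lemma sum_comps_Suc:
  fixes h :: "(nat \<Rightarrow> nat) \<Rightarrow> real"
  shows "(\<Sum>c\<in>comps (Suc n) s. h c) = (\<Sum>j\<le>nat s. \<Sum>c\<in>comps n (s - int j). h (c(n := j)))"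
proof -
  have "(\<Sum>c\<in>comps (Suc n) s. h c) =
      (\<Sum>(j, c)\<in>(SIGMA j:{..nat s}. comps n (s - int j)). h (c(n := j)))"
  proof (rule sum.reindex_bij_witness[of _ "\<lambda>(j, c). c(n := j)" "\<lambda>c. (c n, c(n := 0))"])
    fix c assume c: "c \<in> comps (Suc n) s"
    then have "s = (\<Sum>i<n. int (c i)) + int (c n)"
      by (auto simp: comps_def)
    moreover have "0 \<le> (\<Sum>i<n. int (c i))"
      by (simp add: sum_nonneg)
    ultimately show "(c n, c(n := 0)) \<in> (SIGMA j:{..nat s}. comps n (s - int j))"
      using c by (auto simp: comps_def)
  qed (auto simp: comps_def fun_eq_iff)
  also have "\<dots> = (\<Sum>j\<le>nat s. \<Sum>c\<in>comps n (s - int j). h (c(n := j)))"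
    by (rule sum.Sigma[symmetric]) (auto simp: finite_comps)
  finally show ?thesis .
qed

text \<open>The coefficient of \<open>e\<^sup>\<nu>\<close> in \<open>\<Prod>\<^sub>i\<^sub><\<^sub>j (1 - q e\<^bsup>\<epsilon>\<^sub>j - \<epsilon>\<^sub>i\<^esup>)\<^bsup>-1\<^esup>\<close>, obtained by extracting the
  exponents one variable at a time from the last one: \<open>c i\<close> is the exponent chosen for \<open>\<epsilon>\<^sub>n - \<epsilon>\<^sub>i\<close>.\<close>
fun part_fun :: "nat \<Rightarrow> real \<Rightarrow> (nat \<Rightarrow> int) \<Rightarrow> real" where
  "part_fun 0 q \<nu> = 1"
| "part_fun (Suc n) q \<nu> = q ^ nat (\<nu> n) * (\<Sum>c\<in>comps n (\<nu> n). part_fun n q (\<lambda>i. \<nu> i + int (c i)))"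

lemma part_fun_cong: "(\<And>i. i < n \<Longrightarrow> \<nu> i = \<nu>' i) \<Longrightarrow> part_fun n q \<nu> = part_fun n q \<nu>'"
proof (induction n arbitrary: \<nu> \<nu>')
  case (Suc n)
  then have "part_fun n q (\<lambda>i. \<nu> i + int (c i)) = part_fun n q (\<lambda>i. \<nu>' i + int (c i))" for c
    by (intro Suc.IH) simp
  with Suc.prems[of n] show ?case
    by simp
qed simp

lemma part_fun_neg: "\<nu> n < 0 \<Longrightarrow> part_fun (Suc n) q \<nu> = 0"
  by (simp add: comps_neg)

definition ind :: "nat set \<Rightarrow> nat \<Rightarrow> nat" where
  "ind S i = (if i \<in> S then 1 else 0)"

lemma sum_ind: "S \<subseteq> {..<n} \<Longrightarrow> (\<Sum>i<n. int (ind S i)) = int (card S)"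
  by (simp add: ind_def if_distrib[of int] sum.If_cases Int_absorb1)

lemma sum_Pow_sign:
  assumes "finite A"
  shows "(\<Sum>S\<in>Pow A. (- 1) ^ card S :: real) = (if A = {} then 1 else 0)"
proof -
  have "(\<Prod>a\<in>A. 1 + (- 1 :: real)) = (\<Sum>S\<in>Pow A. (\<Prod>a\<in>A - S. 1) * (\<Prod>a\<in>S. - 1))"
    using prod_add[OF assms, of "\<lambda>_. - 1" "\<lambda>_. 1 :: real"] by (simp add: mult.commute add.commute)
  then have "(\<Sum>S\<in>Pow A. (- 1) ^ card S :: real) = 0 ^ card A"
    by simp
  then show ?thesis
    using assms by (simp add: power_0_left)
qed


text \<open>The identity \<open>(\<Sum>\<^sub>r h\<^sub>r) (\<Sum>\<^sub>r (- 1)\<^sup>r e\<^sub>r) = 1\<close> between the complete and the elementary symmetric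
  functions.\<close>
lemma sum_comps_Pow_cancel:
  fixes h :: "(nat \<Rightarrow> nat) \<Rightarrow> real"
  shows "(\<Sum>S\<in>Pow {..<n}. \<Sum>b\<in>comps n (s - int (card S)). (- 1) ^ card S * h (\<lambda>i. b i + ind S i)) =
    (if s = 0 then h (\<lambda>_. 0) else 0)"
proof -
  have supp: "{i. 0 < d i} \<subseteq> {..<n}" if "d \<in> comps n s" for d
    using that unfolding comps_def by (auto, metis less_irrefl not_le)
  then have fin: "finite {i. 0 < d i}" if "d \<in> comps n s" for d
    using that finite_subset by blast
  have "(\<Sum>S\<in>Pow {..<n}. \<Sum>b\<in>comps n (s - int (card S)). (- 1) ^ card S * h (\<lambda>i. b i + ind S i)) =
    (\<Sum>(S, b)\<in>(SIGMA S:Pow {..<n}. comps n (s - int (card S))). (- 1) ^ card S * h (\<lambda>i. b i + ind S i))"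
    by (intro sum.Sigma) (auto simp: finite_comps)
  \<comment> \<open>The pair \<open>(S, b)\<close> is recorded as \<open>d = b + ind S\<close>
    together with \<open>S\<close>, now an arbitrary subset of the support of \<open>d\<close>. For
    fixed \<open>d\<close> the signs add up to zero unless that support is empty.\<close>
  also have "\<dots> = (\<Sum>(d, S)\<in>(SIGMA d:comps n s. Pow {i. 0 < d i}). (- 1) ^ card S * h d)"
  proof (rule sum.reindex_bij_witness
      [of _ "\<lambda>(d, S). (S, \<lambda>i. d i - ind S i)" "\<lambda>(S, b). (\<lambda>i. b i + ind S i, S)"])
    have "(\<lambda>i. b i + ind S i) \<in> comps n s"
      if *: "S \<subseteq> {..<n}" "b \<in> comps n (s - int (card S))" for S b
    proof -
      have "ind S i = 0" if "n \<le> i" for i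
        using * that by (auto simp: ind_def)
      then show ?thesis
        using * sum_ind[of S n] by (auto simp: comps_def sum.distrib)
    qed
    moreover have "ind S i = 1" if "i \<in> S" for S i
      using that by (simp add: ind_def)
    ultimately show "(case z of (S, b) \<Rightarrow> (\<lambda>i. b i + ind S i, S)) \<in> (SIGMA d:comps n s. Pow {i. 0 < d i})"
      if "z \<in> (SIGMA S:Pow {..<n}. comps n (s - int (card S)))" for z
      using that by auto
    have le: "ind S i \<le> d i" if "S \<subseteq> {i. 0 < d i}" for S and d :: "nat \<Rightarrow> nat" and i
      using that by (auto simp: ind_def)
    then show "(case case z of (d, S) \<Rightarrow> (S, \<lambda>i. d i - ind S i) of (S, b) \<Rightarrow> (\<lambda>i. b i + ind S i, S)) = z"
      if "z \<in> (SIGMA d:comps n s. Pow {i. 0 < d i})" for z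
      using that by (auto simp: fun_eq_iff)
    have "(\<lambda>i. d i - ind S i) \<in> comps n (s - int (card S))"
      if "d \<in> comps n s" "S \<subseteq> {i. 0 < d i}" for d S
      using that supp[of d] le[of S d] sum_ind[of S n] by (auto simp: comps_def of_nat_diff sum_subtractf)
    then show "(case z of (d, S) \<Rightarrow> (S, \<lambda>i. d i - ind S i)) \<in> (SIGMA S:Pow {..<n}. comps n (s - int (card S)))"
      if "z \<in> (SIGMA d:comps n s. Pow {i. 0 < d i})" for z
      using that supp by fastforce
  qed auto
  also have "\<dots> = (\<Sum>d\<in>comps n s. \<Sum>S\<in>Pow {i. 0 < d i}. (- 1) ^ card S * h d)"
    by (subst sum.Sigma) (auto simp: finite_comps fin)
  also have "\<dots> = (\<Sum>d\<in>comps n s. if d = (\<lambda>_. 0) then h d else 0)"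
    by (intro sum.cong refl) (auto simp: sum_Pow_sign fin sum_distrib_right[symmetric])
  also have "\<dots> = (if (\<lambda>_. 0) \<in> comps n s then h (\<lambda>_. 0) else 0)"
    by (simp add: finite_comps sum.delta')
  also have "(\<lambda>_. 0) \<in> comps n s \<longleftrightarrow> s = 0"
    by (auto simp: comps_def)
  finally show ?thesis .
qed

text \<open>The inner sum is a coefficient of the partition series times the complete symmetric
  function of degree \<open>\<Sum>i<n. \<mu> i\<close> in the inverse variables. For positive
  \<open>n\<close> the value turns out to be the one-row Kostka-Foulkes polynomial in
  \<open>n\<close> variables, see \<open>kostka_foulkes_one_row\<close>.\<close>

definition row_sum :: "nat \<Rightarrow> real \<Rightarrow> (nat \<Rightarrow> nat) \<Rightarrow> real" where
  "row_sum n q \<mu> = alt_sum n int (\<lambda>x. \<Sum>b\<in>comps n (\<Sum>i<n. int (\<mu> i)).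
     part_fun n q (\<lambda>i. x i - int i - int (\<mu> i) + int (b i)))"

text \<open>After \<open>alt_sum_vandermonde\<close> the last argument is \<open>n - card S\<close>.
  If \<open>j\<close> is the last part of the composition, the last coordinate passed to
  \<open>part_fun\<close> is \<open>r = j - \<mu> n - card S\<close>, and the other parts have total
  \<open>N - r - card S\<close>. For fixed \<open>r\<close> and \<open>c\<close>, summing over
  \<open>S\<close> and these parts is therefore \<open>sum_comps_Pow_cancel\<close> in degree
  \<open>N - r\<close>, and only \<open>r = N\<close> remains. In particular \<open>\<mu> n\<close>
  drops out.\<close>

lemma row_sum_Suc: "row_sum (Suc n) q \<mu> = q ^ (\<Sum>i<n. \<mu> i) * row_sum n q \<mu>"
proof -
  define N where "N = (\<Sum>i<n. \<mu> i)"
  have N: "(\<Sum>i<n. int (\<mu> i)) = int N"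
    by (simp add: N_def)
  define f where "f x = (\<Sum>b\<in>comps (Suc n) (\<Sum>i<Suc n. int (\<mu> i)).
     part_fun (Suc n) q (\<lambda>i. x i - int i - int (\<mu> i) + int (b i)))" for x
  have main: "(\<Sum>S\<in>Pow {..<n}. (-1) ^ card S * f ((shift S x)(n := int n - int (card S)))) =
      q ^ N * (\<Sum>c\<in>comps n (int N). part_fun n q (\<lambda>i. x i - int i - int (\<mu> i) + int (c i)))" for x
  proof -
    define p where "p e = part_fun n q (\<lambda>i. x i - int i - int (\<mu> i) + int (e i))" for e :: "nat \<Rightarrow> nat"
    have f: "f ((shift S x)(n := int n - int (card S))) =
        (\<Sum>r\<le>N. q ^ r * (\<Sum>b\<in>comps n (int N - int r - int (card S)). \<Sum>c\<in>comps n (int r). p (\<lambda>i. b i + ind S i + c i)))"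
      if "S \<subseteq> {..<n}" for S
    proof -
      define H where "H j = (\<Sum>b\<in>comps n (int N + int (\<mu> n) - int j).
        q ^ (j - (\<mu> n + card S)) * (\<Sum>c\<in>comps n (int j - int (\<mu> n) - int (card S)). p (\<lambda>i. b i + ind S i + c i)))" for j
      have "f ((shift S x)(n := int n - int (card S))) = (\<Sum>j\<le>N + \<mu> n. H j)"
      proof -
        have "part_fun (Suc n) q (\<lambda>i. ((shift S x)(n := int n - int (card S))) i - int i - int (\<mu> i) + int ((b(n := j)) i)) =
          q ^ (j - (\<mu> n + card S)) * (\<Sum>c\<in>comps n (int j - int (\<mu> n) - int (card S)). p (\<lambda>i. b i + ind S i + c i))" for b j
        proof -
          have 1: "nat (int j - int (\<mu> n) - int (card S)) = j - (\<mu> n + card S)"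
            by simp
          have 2: "int n - int (card S) - int n - int (\<mu> n) + int j = int j - int (\<mu> n) - int (card S)"
            by simp
          have "part_fun n q (\<lambda>i. ((shift S x)(n := int n - int (card S))) i - int i - int (\<mu> i) + int ((b(n := j)) i) + int (c i)) =
              p (\<lambda>i. b i + ind S i + c i)" for c
            unfolding p_def by (rule part_fun_cong) (auto simp: shift_def ind_def)
          then show ?thesis
            by (simp only: part_fun.simps fun_upd_same 1 2)
        qed
        then show ?thesis
          by (simp only: f_def sum_comps_Suc H_def sum.lessThan_Suc N of_nat_add[symmetric] nat_int)
      qed
      \<comment> \<open>Neither range contains the other. Below \<open>\<mu> n + card S\<close> the
        last coordinate is negative, and above \<open>N + \<mu> n\<close> the remaining parts have
        negative total; both kinds of terms are zero.\<close>
      also have "\<dots> = (\<Sum>j\<in>(\<lambda>r. r + (\<mu> n + card S)) ` {..N}. H j)"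
      proof (rule sum.mono_neutral_cong)
        show "H j = 0" if "j \<in> {..N + \<mu> n} - (\<lambda>r. r + (\<mu> n + card S)) ` {..N}" for j
        proof -
          have "j < \<mu> n + card S"
          proof (rule ccontr)
            assume "\<not> j < \<mu> n + card S"
            then have "j = (j - (\<mu> n + card S)) + (\<mu> n + card S)" "j - (\<mu> n + card S) \<in> {..N}"
              using that by auto
            with that show False by blast
          qed
          then show ?thesis
            by (simp add: H_def comps_neg)
        qed
        show "H j = 0" if "j \<in> (\<lambda>r. r + (\<mu> n + card S)) ` {..N} - {..N + \<mu> n}" for j
          using that by (auto simp: H_def comps_neg)
      qed auto
      also have "\<dots> = (\<Sum>r\<le>N. H (r + (\<mu> n + card S)))"
        by (subst sum.reindex) (auto simp: inj_on_def)
      also have "\<dots> = (\<Sum>r\<le>N. q ^ r * (\<Sum>b\<in>comps n (int N - int r - int (card S)). \<Sum>c\<in>comps n (int r). p (\<lambda>i. b i + ind S i + c i)))"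
        by (simp add: H_def sum_distrib_left[symmetric] algebra_simps)
      finally show ?thesis .
    qed
    have "(\<Sum>S\<in>Pow {..<n}. (-1) ^ card S * f ((shift S x)(n := int n - int (card S)))) =
      (\<Sum>S\<in>Pow {..<n}. \<Sum>r\<le>N. \<Sum>c\<in>comps n (int r). \<Sum>b\<in>comps n (int N - int r - int (card S)).
        q ^ r * ((-1) ^ card S * p (\<lambda>i. b i + ind S i + c i)))"
    proof (rule sum.cong[OF refl])
      fix S assume "S \<in> Pow {..<n}"
      then show "(-1) ^ card S * f ((shift S x)(n := int n - int (card S))) =
        (\<Sum>r\<le>N. \<Sum>c\<in>comps n (int r). \<Sum>b\<in>comps n (int N - int r - int (card S)).
        q ^ r * ((-1) ^ card S * p (\<lambda>i. b i + ind S i + c i)))"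
        by (subst sum.swap[of _ "comps n (int N - int r - int (card S))" "comps n (int r)" for r])
          (simp add: f sum_distrib_left mult.left_commute)
    qed
    also have "\<dots> = (\<Sum>r\<le>N. \<Sum>c\<in>comps n (int r). \<Sum>S\<in>Pow {..<n}. \<Sum>b\<in>comps n (int N - int r - int (card S)).
        q ^ r * ((-1) ^ card S * p (\<lambda>i. b i + ind S i + c i)))"
      by (subst sum.swap, intro sum.cong refl, rule sum.swap)
    also have "\<dots> = (\<Sum>r\<le>N. \<Sum>c\<in>comps n (int r). q ^ r * (if int N - int r = 0 then p c else 0))"
    proof (intro sum.cong refl)
      fix r c
      show "(\<Sum>S\<in>Pow {..<n}. \<Sum>b\<in>comps n (int N - int r - int (card S)).
        q ^ r * ((-1) ^ card S * p (\<lambda>i. b i + ind S i + c i))) = q ^ r * (if int N - int r = 0 then p c else 0)"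
        using sum_comps_Pow_cancel[where n = n and s = "int N - int r" and h = "\<lambda>e. p (\<lambda>i. e i + c i)"]
        by (simp add: sum_distrib_left[symmetric])
    qed
    also have "\<dots> = (\<Sum>r\<le>N. if r = N then q ^ r * (\<Sum>c\<in>comps n (int r). p c) else 0)"
      by (intro sum.cong refl) (auto simp: sum_distrib_left)
    also have "\<dots> = q ^ N * (\<Sum>c\<in>comps n (int N). p c)"
      by (simp add: sum.delta')
    finally show ?thesis
      by (simp only: p_def)
  qed
  have "row_sum (Suc n) q \<mu> = alt_sum (Suc n) int f"
    by (simp only: row_sum_def f_def[abs_def])
  also have "\<dots> = alt_sum n int (\<lambda>x. q ^ N *
      (\<Sum>c\<in>comps n (int N). part_fun n q (\<lambda>i. x i - int i - int (\<mu> i) + int (c i))))"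
    unfolding alt_sum_vandermonde main ..
  also have "\<dots> = q ^ N * row_sum n q \<mu>"
    by (simp add: row_sum_def alt_sum_def N sum_distrib_left mult.left_commute)
  finally show ?thesis
    by (simp only: N_def)
qed

text \<open>The passage from \<open>k\<close> to \<open>k + 1\<close> variables contributes every
  \<open>\<mu> i\<close> with \<open>i < k\<close>, so \<open>\<mu> i\<close> is counted once for
  each of the \<open>n - 1 - i\<close> later indices.\<close>

lemma row_sum_eq: "row_sum n q \<mu> = q ^ (\<Sum>i<n. (n - 1 - i) * \<mu> i)"
proof (induction n)
  case 0
  have "comps 0 0 = {\<lambda>_. 0}"
    by (auto simp: comps_def)
  then show ?case
    by (simp add: row_sum_def alt_sum_def)
next
  case (Suc n)
  have "(\<Sum>i<n. \<mu> i) + (\<Sum>i<n. (n - 1 - i) * \<mu> i) = (\<Sum>i<Suc n. (Suc n - 1 - i) * \<mu> i)"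
  proof -
    have "\<mu> i + (n - 1 - i) * \<mu> i = (n - i) * \<mu> i" if "i < n" for i
    proof -
      have "n - i = Suc (n - 1 - i)"
        using that by simp
      then show ?thesis by simp
    qed
    then show ?thesis
      by (simp add: sum.distrib[symmetric])
  qed
  then show ?case
    by (simp only: row_sum_Suc Suc power_add[symmetric])
qed

section \<open>Kostant's partition function in coordinates\<close>

definition pairs :: "nat \<Rightarrow> (nat \<times> nat) set" where
  "pairs n = {(i, j). i < j \<and> j < n}"

definition root_vec :: "nat \<Rightarrow> nat \<times> nat \<Rightarrow> int vec" where
  "root_vec n p = unit_vec n (fst p) - unit_vec n (snd p)"

lemma finite_pairs: "finite (pairs n)"
  by (rule finite_subset[of _ "{..<n} \<times> {..<n}"]) (auto simp: pairs_def)

lemma pairs_Suc: "pairs (Suc n) = pairs n \<union> (\<lambda>i. (i, n)) ` {..<n}"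
  by (auto simp: pairs_def less_Suc_eq)

lemma pos_roots_eq: "pos_roots n = root_vec n ` pairs n"
  by (fastforce simp: pos_roots_def root_vec_def pairs_def image_def)

lemma root_vec_index:
  assumes "p \<in> pairs n" "k < n"
  shows "root_vec n p $ k = (if k = fst p then 1 else if k = snd p then - 1 else 0)"
  using assms by (auto simp: root_vec_def pairs_def)

lemma inj_on_root_vec: "inj_on (root_vec n) (pairs n)"
proof (rule inj_onI)
  fix p p' assume *: "p \<in> pairs n" "p' \<in> pairs n" "root_vec n p = root_vec n p'"
  then have lt: "fst p < n" "snd p < n" "fst p < snd p" "fst p' < snd p'"
    by (auto simp: pairs_def)
  have "(if k = fst p then 1 else if k = snd p then - 1 else 0) =
      (if k = fst p' then 1 else if k = snd p' then - 1 else (0 :: int))" if "k < n" for k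
    using *(3) root_vec_index[OF *(1) that] root_vec_index[OF *(2) that] by simp
  from this[of "fst p"] this[of "snd p"] have "fst p = fst p' \<and> snd p = snd p'"
    using lt by (auto split: if_splits)
  then show "p = p'"
    by (simp add: prod_eq_iff)
qed

lemma sum_pos_roots: "(\<Sum>\<alpha>\<in>pos_roots n. f \<alpha>) = (\<Sum>p\<in>pairs n. f (root_vec n p))"
  unfolding pos_roots_eq by (simp add: sum.reindex[OF inj_on_root_vec])

lemma prod_pos_roots: "(\<Prod>\<alpha>\<in>pos_roots n. f \<alpha>) = (\<Prod>p\<in>pairs n. f (root_vec n p))"
  unfolding pos_roots_eq by (simp add: prod.reindex[OF inj_on_root_vec])

lemma sum_root_vec_index:
  fixes f :: "nat \<times> nat \<Rightarrow> real"
  assumes "k < n"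
  shows "(\<Sum>p\<in>pairs n. f p * of_int ((- root_vec n p) $ k)) =
    (\<Sum>i<k. f (i, k)) - (\<Sum>j\<in>{k<..<n}. f (k, j))"
proof -
  have "(\<Sum>p\<in>pairs n. f p * of_int ((- root_vec n p) $ k)) =
      (\<Sum>p\<in>pairs n. (if snd p = k then f p else 0) - (if fst p = k then f p else 0))"
  proof (rule sum.cong[OF refl])
    fix p assume p: "p \<in> pairs n"
    have "(- root_vec n p) $ k = - (root_vec n p $ k)"
      using assms by (simp add: root_vec_def)
    then show "f p * of_int ((- root_vec n p) $ k) = (if snd p = k then f p else 0) - (if fst p = k then f p else 0)"
      using p assms by (auto simp: root_vec_index pairs_def)
  qed
  also have "\<dots> = (\<Sum>p | p \<in> pairs n \<and> snd p = k. f p) - (\<Sum>p | p \<in> pairs n \<and> fst p = k. f p)"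
    by (simp add: sum_subtractf sum.inter_filter finite_pairs)
  also have "{p. p \<in> pairs n \<and> snd p = k} = (\<lambda>i. (i, k)) ` {..<k}"
    using assms by (auto simp: pairs_def)
  also have "{p. p \<in> pairs n \<and> fst p = k} = (\<lambda>j. (k, j)) ` {k<..<n}"
    using assms by (auto simp: pairs_def)
  finally show ?thesis
    by (simp add: sum.reindex inj_on_def)
qed

lemma rho_minus_index:
  assumes "k < n"
  shows "rho_minus n $ k = real k - (real n - 1) / 2"
proof -
  have "rho_minus n $ k = (\<Sum>p\<in>pairs n. 1 * of_int ((- root_vec n p) $ k)) / 2"
    using assms by (simp add: rho_minus_def sum_pos_roots)
  also have "\<dots> = (real k - real (n - Suc k)) / 2"
    using sum_root_vec_index[OF assms, of "\<lambda>_. 1"] by simp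
  also have "\<dots> = real k - (real n - 1) / 2"
    using assms by (simp add: of_nat_diff field_simps)
  finally show ?thesis .
qed

text \<open>The exponent families of \<open>kostant_partition\<close>, indexed by pairs instead of
  root vectors and with 0 rather than \<open>undefined\<close> as value elsewhere, so that families
  for \<open>n\<close> and for \<open>Suc n\<close> are comparable.\<close>

definition partitions :: "nat \<Rightarrow> (nat \<Rightarrow> int) \<Rightarrow> (nat \<times> nat \<Rightarrow> nat) set" where
  "partitions n \<nu> = {m. (\<forall>p. p \<notin> pairs n \<longrightarrow> m p = 0) \<and>
     (\<forall>k<n. (\<Sum>i<k. int (m (i, k))) - (\<Sum>j\<in>{k<..<n}. int (m (k, j))) = \<nu> k)}"

text \<open>Induction splits off the column \<open>m (i, n)\<close>. Coordinate \<open>n\<close>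
  forces its total to be \<open>\<nu> n\<close>; in coordinate \<open>i < n\<close> it moves to the
  right-hand side and turns \<open>\<nu> i\<close> into \<open>\<nu> i + m (i, n)\<close>. This is
  the recursion of \<open>part_fun\<close>. Finiteness is carried along because regrouping the sum
  by columns needs it.\<close>

lemma sum_partitions:
  "finite (partitions n \<nu>) \<and> (\<Sum>m\<in>partitions n \<nu>. \<Prod>p\<in>pairs n. q ^ m p) = part_fun n q \<nu>"
proof (induction n arbitrary: \<nu>)
  case 0
  have "partitions 0 \<nu> = {\<lambda>_. 0}" "pairs 0 = {}"
    by (auto simp: partitions_def pairs_def)
  then show ?case by simp
next
  case (Suc n)
  define X where "X = (SIGMA c:comps n (\<nu> n). partitions n (\<lambda>i. \<nu> i + int (c i)))"
  define F :: "(nat \<Rightarrow> nat) \<times> (nat \<times> nat \<Rightarrow> nat) \<Rightarrow> nat \<times> nat \<Rightarrow> nat"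
    where "F = (\<lambda>(c, m) (i, j). if j = n then c i else m (i, j))"
  define G where "G m = (\<lambda>i. m (i, n), \<lambda>(i, j). if j = n then 0 else m (i, j))" for m :: "nat \<times> nat \<Rightarrow> nat"
  have greater: "{k<..<Suc n} = insert n {k<..<n}" if "k < n" for k
    using that by auto
  have last: "(\<Sum>i<n. int (m (i, n))) = \<nu> n" if m: "m \<in> partitions (Suc n) \<nu>" for m
  proof -
    have "(\<Sum>i<n. int (m (i, n))) - (\<Sum>j\<in>{n<..<Suc n}. int (m (n, j))) = \<nu> n"
      using m unfolding partitions_def by blast
    moreover have "{n<..<Suc n} = {}"
      by auto
    ultimately show ?thesis by simp
  qed
  have G: "G m \<in> X" if m: "m \<in> partitions (Suc n) \<nu>" for m
  proof -
    have "\<forall>i\<ge>n. m (i, n) = 0"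
      using m by (auto simp: partitions_def pairs_def)
    moreover have "(\<Sum>i<n. int (m (i, n))) = \<nu> n"
      by (rule last[OF m])
    moreover have "(\<lambda>(i, j). if j = n then 0 else m (i, j)) \<in> partitions n (\<lambda>i. \<nu> i + int (m (i, n)))"
    proof -
      have "(\<Sum>i<k. int (m (i, k))) - (\<Sum>j\<in>{k<..<n}. int (m (k, j))) = \<nu> k + int (m (k, n))" if "k < n" for k
      proof -
        have "(\<Sum>i<k. int (m (i, k))) - (\<Sum>j\<in>{k<..<Suc n}. int (m (k, j))) = \<nu> k"
          using m that by (auto simp: partitions_def)
        then show ?thesis
          by (simp add: greater that)
      qed
      then show ?thesis
        using m by (auto simp: partitions_def pairs_def)
    qed
    ultimately show ?thesis
      by (simp add: G_def X_def comps_def)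
  qed
  have F: "F (c, m) \<in> partitions (Suc n) \<nu>"
    if c: "c \<in> comps n (\<nu> n)" and m: "m \<in> partitions n (\<lambda>i. \<nu> i + int (c i))" for c m
  proof -
    have "(\<Sum>i<k. int (m (i, k))) - (\<Sum>j\<in>{k<..<Suc n}. int (if j = n then c k else m (k, j))) = \<nu> k" if "k < n" for k
      using m that by (auto simp: partitions_def greater)
    then show ?thesis
      using c m by (auto simp: F_def partitions_def comps_def pairs_def less_Suc_eq)
  qed
  have FG: "F (G m) = m" for m
    by (auto simp: F_def G_def fun_eq_iff)
  have GF: "G (F (c, m)) = (c, m)" if "m \<in> partitions n \<nu>'" for c m \<nu>'
    using that by (auto simp: F_def G_def fun_eq_iff partitions_def pairs_def)
  have "partitions (Suc n) \<nu> \<subseteq> F ` X"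
    using G FG by (metis image_eqI subsetI)
  moreover have "finite X"
    unfolding X_def using Suc by (intro finite_SigmaI finite_comps) auto
  ultimately have fin: "finite (partitions (Suc n) \<nu>)"
    by (rule finite_surj[rotated])
  have "(\<Sum>m\<in>partitions (Suc n) \<nu>. \<Prod>p\<in>pairs (Suc n). q ^ m p) =
      (\<Sum>z\<in>X. q ^ nat (\<nu> n) * (\<Prod>p\<in>pairs n. q ^ snd z p))"
  proof (rule sum.reindex_bij_witness[of _ F G])
    fix m assume m: "m \<in> partitions (Suc n) \<nu>"
    show "F (G m) = m" by (rule FG)
    show "G m \<in> X" using m by (rule G)
    have "(\<Prod>p\<in>pairs (Suc n). q ^ m p) = (\<Prod>p\<in>pairs n. q ^ m p) * (\<Prod>i<n. q ^ m (i, n))"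
    proof -
      have "pairs n \<inter> (\<lambda>i. (i, n)) ` {..<n} = {}"
        by (auto simp: pairs_def)
      then show ?thesis
        unfolding pairs_Suc by (simp add: prod.union_disjoint finite_pairs prod.reindex inj_on_def)
    qed
    also have "(\<Prod>i<n. q ^ m (i, n)) = q ^ nat (\<nu> n)"
    proof -
      have "int (\<Sum>i<n. m (i, n)) = \<nu> n"
        using last[OF m] by simp
      then have "nat (\<nu> n) = (\<Sum>i<n. m (i, n))"
        by (metis nat_int)
      then show ?thesis
        by (simp add: power_sum)
    qed
    also have "(\<Prod>p\<in>pairs n. q ^ m p) = (\<Prod>p\<in>pairs n. q ^ snd (G m) p)"
      by (intro prod.cong) (auto simp: G_def pairs_def)
    finally show "q ^ nat (\<nu> n) * (\<Prod>p\<in>pairs n. q ^ snd (G m) p) = (\<Prod>p\<in>pairs (Suc n). q ^ m p)"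
      by simp
  next
    fix z assume "z \<in> X"
    then show "G (F z) = z" "F z \<in> partitions (Suc n) \<nu>"
      using F GF by (auto simp: X_def)
  qed
  also have "\<dots> = (\<Sum>c\<in>comps n (\<nu> n). \<Sum>m\<in>partitions n (\<lambda>i. \<nu> i + int (c i)).
      q ^ nat (\<nu> n) * (\<Prod>p\<in>pairs n. q ^ m p))"
    unfolding X_def using Suc by (subst sum.Sigma) (auto simp: finite_comps split_def)
  also have "\<dots> = part_fun (Suc n) q \<nu>"
    using Suc by (simp add: sum_distrib_left[symmetric])
  finally show ?case
    using fin by blast
qed

lemma kostant_partition_eq:
  assumes "dim_vec x = n" "\<And>k. k < n \<Longrightarrow> x $ k = of_int (\<nu> k)"
  shows "kostant_partition n x q = part_fun n q \<nu>"
proof -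
  define R where "R = inv_into (pairs n) (root_vec n)"
  have R: "R (root_vec n p) = p" if "p \<in> pairs n" for p
    unfolding R_def using that by (rule inv_into_f_f[OF inj_on_root_vec])
  have root: "\<alpha> \<in> pos_roots n \<longleftrightarrow> (\<exists>p\<in>pairs n. \<alpha> = root_vec n p)" for \<alpha>
    by (auto simp: pos_roots_eq)
  have eq: "x = vec n (\<lambda>k. \<Sum>\<alpha>\<in>pos_roots n. of_nat (m \<alpha>) * of_int ((- \<alpha>) $ k)) \<longleftrightarrow>
      (\<forall>k<n. (\<Sum>i<k. int (m (root_vec n (i, k)))) - (\<Sum>j\<in>{k<..<n}. int (m (root_vec n (k, j)))) = \<nu> k)"
    (is "?L \<longleftrightarrow> ?R") for m :: "int vec \<Rightarrow> nat"
  proof -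
    have "x $ k = (\<Sum>\<alpha>\<in>pos_roots n. of_nat (m \<alpha>) * of_int ((- \<alpha>) $ k)) \<longleftrightarrow>
      (\<Sum>i<k. int (m (root_vec n (i, k)))) - (\<Sum>j\<in>{k<..<n}. int (m (root_vec n (k, j)))) = \<nu> k" if "k < n" for k
    proof -
      have "(\<Sum>\<alpha>\<in>pos_roots n. of_nat (m \<alpha>) * of_int ((- \<alpha>) $ k)) =
        real_of_int ((\<Sum>i<k. int (m (root_vec n (i, k)))) - (\<Sum>j\<in>{k<..<n}. int (m (root_vec n (k, j)))))"
        using sum_root_vec_index[OF that, of "\<lambda>p. real (m (root_vec n p))"] by (simp add: sum_pos_roots)
      then show ?thesis
        unfolding assms(2)[OF that] by (simp only: of_int_eq_iff eq_commute)
    qed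
    then show ?thesis
      using assms(1) by (auto simp: vec_eq_iff)
  qed
  define A where "A = {m. m \<in> pos_roots n \<rightarrow>\<^sub>E (UNIV :: nat set) \<and>
    x = vec n (\<lambda>k. \<Sum>\<alpha>\<in>pos_roots n. of_nat (m \<alpha>) * of_int ((- \<alpha>) $ k))}"
  have "kostant_partition n x q = (\<Sum>m\<in>A. \<Prod>p\<in>pairs n. q ^ m (root_vec n p))"
    by (simp only: kostant_partition_def A_def prod_pos_roots)
  also have "\<dots> = (\<Sum>m\<in>partitions n \<nu>. \<Prod>p\<in>pairs n. q ^ m p)"
  proof (rule sum.reindex_bij_witness[of _ "\<lambda>m. restrict (m \<circ> R) (pos_roots n)"
      "\<lambda>m p. if p \<in> pairs n then m (root_vec n p) else 0"])
    have mem: "(i, k) \<in> pairs n \<longleftrightarrow> i < k \<and> k < n" for i k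
      by (simp add: pairs_def)
    fix m assume m: "m \<in> A"
    show "restrict ((\<lambda>p. if p \<in> pairs n then m (root_vec n p) else 0) \<circ> R) (pos_roots n) = m"
      using m by (auto simp: A_def fun_eq_iff root R PiE_def extensional_def restrict_def)
    show "(\<lambda>p. if p \<in> pairs n then m (root_vec n p) else 0) \<in> partitions n \<nu>"
      using m by (auto simp: A_def partitions_def eq mem cong: sum.cong_simp)
    show "(\<Prod>p\<in>pairs n. q ^ (if p \<in> pairs n then m (root_vec n p) else 0)) = (\<Prod>p\<in>pairs n. q ^ m (root_vec n p))"
      by simp
  next
    have mem: "(i, k) \<in> pairs n \<longleftrightarrow> i < k \<and> k < n" for i k
      by (simp add: pairs_def)
    fix m assume m: "m \<in> partitions n \<nu>"
    have *: "restrict (m \<circ> R) (pos_roots n) (root_vec n p) = m p" if "p \<in> pairs n" for p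
      using that by (auto simp: root R)
    show "(\<lambda>p. if p \<in> pairs n then restrict (m \<circ> R) (pos_roots n) (root_vec n p) else 0) = m"
      using m * by (auto simp: partitions_def)
    have "x = vec n (\<lambda>k. \<Sum>\<alpha>\<in>pos_roots n. of_nat (restrict (m \<circ> R) (pos_roots n) \<alpha>) * of_int ((- \<alpha>) $ k))"
      unfolding eq using m by (simp add: * partitions_def mem del: restrict_apply cong: sum.cong_simp)
    then show "restrict (m \<circ> R) (pos_roots n) \<in> A"
      by (auto simp: A_def)
  qed
  finally show ?thesis
    using sum_partitions by simp
qed

text \<open>When \<open>w n = n\<close> the last coordinate is \<open>N - m n\<close>, the sum of
  the other \<open>m i\<close>. It determines both the power of \<open>q\<close> and the total of
  the exponents paired with the last index; the remaining coordinates are those in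
  \<open>row_sum n\<close>.\<close>

lemma kostka_foulkes_one_row:
  assumes "\<kappa> \<in> cochars (Suc n)" "\<mu> \<in> cochars (Suc n)"
    and \<kappa>: "\<And>i. i < Suc n \<Longrightarrow> \<kappa> $ i = (if i = n then int (\<Sum>i<Suc n. m i) else 0)"
    and \<mu>: "\<And>i. i < Suc n \<Longrightarrow> \<mu> $ i = int (m i)"
  shows "kostka_foulkes (Suc n) \<kappa> \<mu> q = q ^ (\<Sum>i<Suc n. (n - i) * m i)"
proof -
  have dim: "dim_vec \<kappa> = Suc n" "dim_vec \<mu> = Suc n" "dim_vec (rho_minus (Suc n)) = Suc n"
    using assms(1,2) by (auto simp: cochars_def rho_minus_def)
  define N where "N = (\<Sum>i<Suc n. m i)"
  define g where "g w = part_fun (Suc n) q (\<lambda>k. (if w k = n then int N else 0) + int (w k) - int k - int (m k))" for w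
  have "kostka_foulkes (Suc n) \<kappa> \<mu> q = (\<Sum>w | w permutes {..<Suc n}. of_int (sign w) * g (inv_into UNIV w))"
    unfolding kostka_foulkes_def
  proof (rule sum.cong[OF refl])
    fix w assume "w \<in> {w. w permutes {..<Suc n}}"
    then have w: "w permutes {..<Suc n}" by simp
    have inv: "inv_into UNIV w k < Suc n" if "k < Suc n" for k
      using permutes_in_image[OF permutes_inv[OF w], of k] that by simp
    \<comment> \<open>The half-integral constants of the two copies of \<rho> cancel, so the real
      vector has integer coordinates.\<close>
    have "kostant_partition (Suc n) (weyl_act w (map_vec of_int \<kappa> + rho_minus (Suc n)) -
        (map_vec of_int \<mu> + rho_minus (Suc n))) q = g (inv_into UNIV w)"
      unfolding g_def
    proof (rule kostant_partition_eq)
      fix k assume "k < Suc n"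
      then show "(weyl_act w (map_vec of_int \<kappa> + rho_minus (Suc n)) -
        (map_vec of_int \<mu> + rho_minus (Suc n))) $ k =
        real_of_int ((if inv_into UNIV w k = n then int N else 0) + int (inv_into UNIV w k) - int k - int (m k))"
        using inv[of k] dim \<kappa>[of "inv_into UNIV w k"] \<mu>[of k]
        by (simp add: weyl_act_def rho_minus_index N_def del: sum.lessThan_Suc)
    qed (use dim in simp)
    then show "(-1) ^ weyl_length (Suc n) w * kostant_partition (Suc n)
        (weyl_act w (map_vec of_int \<kappa> + rho_minus (Suc n)) - (map_vec of_int \<mu> + rho_minus (Suc n))) q =
      of_int (sign w) * g (inv_into UNIV w)"
      by (simp add: minus_one_power_weyl_length[OF w])
  qed
  \<comment> \<open>\<open>weyl_act\<close> involves the inverse of \<open>w\<close>; inversion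
    permutes the group and preserves signs.\<close>
  also have "\<dots> = (\<Sum>w | w permutes {..<Suc n}. of_int (sign w) * g w)"
    by (subst (2) sum_permutations_inverse)
      (auto intro!: sum.cong simp: sign_inverse permutes_imp_permutation[OF finite_lessThan])
  also have "\<dots> = (\<Sum>w | w permutes {..<n}. of_int (sign w) * g w)"
  proof (rule sum.mono_neutral_right)
    show "{w. w permutes {..<n}} \<subseteq> {w. w permutes {..<Suc n}}"
      by (auto intro: permutes_subset)
    show "\<forall>w\<in>{w. w permutes {..<Suc n}} - {w. w permutes {..<n}}. of_int (sign w) * g w = 0"
    proof
      fix w assume w: "w \<in> {w. w permutes {..<Suc n}} - {w. w permutes {..<n}}"
      have "w n \<noteq> n"
        using w permutes_superset[of w "{..<Suc n}" "{..<n}"] by (auto simp: less_Suc_eq)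
      moreover have "w n < Suc n"
        using w permutes_in_image[of w "{..<Suc n}" n] by simp
      ultimately have "w n < n" by simp
      then show "of_int (sign w) * g w = 0"
        unfolding g_def by (subst part_fun_neg) auto
    qed
  qed (simp add: finite_permutations)
  also have "\<dots> = (\<Sum>w | w permutes {..<n}. of_int (sign w) * (q ^ (\<Sum>i<n. m i) *
      (\<Sum>b\<in>comps n (\<Sum>i<n. int (m i)). part_fun n q (\<lambda>i. int (w i) - int i - int (m i) + int (b i)))))"
  proof (intro sum.cong refl arg_cong2[of _ _ _ _ "(*)"])
    fix w assume "w \<in> {w. w permutes {..<n}}"
    then have w: "w permutes {..<n}" by simp
    have wn: "w n = n"
      using permutes_not_in[OF w] by simp
    have *: "int N + int n - int n - int (m n) = int (\<Sum>i<n. m i)"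
      by (simp add: N_def)
    have "part_fun n q (\<lambda>k. (if w k = n then int N else 0) + int (w k) - int k - int (m k) + int (b k)) =
        part_fun n q (\<lambda>i. int (w i) - int i - int (m i) + int (b i))" for b
    proof (rule part_fun_cong)
      fix i assume "i < n"
      then have "w i \<noteq> n"
        using permutes_in_image[OF w, of i] by auto
      then show "(if w i = n then int N else 0) + int (w i) - int i - int (m i) + int (b i) =
          int (w i) - int i - int (m i) + int (b i)"
        by simp
    qed
    then show "g w = q ^ (\<Sum>i<n. m i) *
      (\<Sum>b\<in>comps n (\<Sum>i<n. int (m i)). part_fun n q (\<lambda>i. int (w i) - int i - int (m i) + int (b i)))"
      unfolding g_def part_fun.simps wn by (simp only: if_True refl * nat_int) (simp add: of_nat_sum)
  qed
  \<comment> \<open>The recursion read backwards: the prefactor is absorbed by adding the last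
    variable again.\<close>
  also have "\<dots> = row_sum (Suc n) q m"
    unfolding row_sum_Suc by (simp add: row_sum_def alt_sum_def sum_distrib_left mult.left_commute)
  also have "\<dots> = q ^ (\<Sum>i<Suc n. (n - i) * m i)"
    by (simp only: row_sum_eq diff_Suc_1)
  finally show ?thesis .
qed


section \<open>The dominance order below a one-row cocharacter\<close>

lemma simple_roots_eq: "simple_roots n = (\<lambda>i. root_vec n (i, Suc i)) ` {i. Suc i < n}"
  by (auto simp: simple_roots_def root_vec_def)

lemma inj_on_simple_root: "inj_on (\<lambda>i. root_vec n (i, Suc i)) {i. Suc i < n}"
  using inj_on_root_vec[of n] by (auto simp: inj_on_def pairs_def)

lemma simple_root_scalar_prod:
  assumes "Suc i < n" "\<mu> \<in> carrier_vec n"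
  shows "root_vec n (i, Suc i) \<bullet> \<mu> = \<mu> $ i - \<mu> $ Suc i"
  using assms by (simp add: root_vec_def minus_scalar_prod_distrib[of _ n])

lemma cochars_minus_iff:
  "\<mu> \<in> cochars_minus n \<longleftrightarrow> \<mu> \<in> cochars n \<and> (\<forall>i j. i \<le> j \<and> j < n \<longrightarrow> \<mu> $ i \<le> \<mu> $ j)"
proof -
  have "(\<forall>i. Suc i < n \<longrightarrow> \<mu> $ i \<le> \<mu> $ Suc i) \<longleftrightarrow> (\<forall>i j. i \<le> j \<and> j < n \<longrightarrow> \<mu> $ i \<le> \<mu> $ j)"
  proof (intro iffI allI impI)
    fix i j assume *: "\<forall>i. Suc i < n \<longrightarrow> \<mu> $ i \<le> \<mu> $ Suc i" and "i \<le> j \<and> j < n"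
    then have "i \<le> j" "j < n" by auto
    then show "\<mu> $ i \<le> \<mu> $ j"
    proof (induction j rule: dec_induct)
      case (step j)
      with *[rule_format, of j] show ?case by simp
    qed simp
  qed auto
  then show ?thesis
    by (auto simp: cochars_minus_def cochars_def simple_roots_eq simple_root_scalar_prod)
qed

lemma Lam_iff:
  "\<mu> \<in> Lam n \<longleftrightarrow> \<mu> \<in> cochars n \<and> (\<forall>i<n. 0 \<le> \<mu> $ i) \<and> (\<forall>i j. i \<le> j \<and> j < n \<longrightarrow> \<mu> $ i \<le> \<mu> $ j)"
  by (auto simp: Lam_def cochars_minus_iff)

lemma sum_simple_roots_index:
  fixes c :: "int vec \<Rightarrow> nat"
  assumes "k < Suc d"
  shows "(\<Sum>\<alpha>\<in>simple_roots (Suc d). int (c \<alpha>) * (- \<alpha>) $ k) =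
    (if 0 < k then int (c (root_vec (Suc d) (k - 1, k))) else 0) -
    (if k < d then int (c (root_vec (Suc d) (k, Suc k))) else 0)"
proof -
  have "(\<Sum>\<alpha>\<in>simple_roots (Suc d). int (c \<alpha>) * (- \<alpha>) $ k) =
      (\<Sum>i<d. int (c (root_vec (Suc d) (i, Suc i))) * (- root_vec (Suc d) (i, Suc i)) $ k)"
    unfolding simple_roots_eq by (subst sum.reindex[OF inj_on_simple_root]) (auto simp: lessThan_def)
  \<comment> \<open>For \<open>k = 0\<close> the truncated \<open>k - 1\<close> is again 0; the
    guard \<open>0 < k\<close> removes that spurious term.\<close>
  also have "\<dots> = (\<Sum>i<d. (if i = k - 1 then if 0 < k then int (c (root_vec (Suc d) (i, Suc i))) else 0 else 0) -
      (if i = k then int (c (root_vec (Suc d) (i, Suc i))) else 0))"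
  proof (rule sum.cong[OF refl])
    fix i assume "i \<in> {..<d}"
    then show "int (c (root_vec (Suc d) (i, Suc i))) * (- root_vec (Suc d) (i, Suc i)) $ k =
      (if i = k - 1 then if 0 < k then int (c (root_vec (Suc d) (i, Suc i))) else 0 else 0) -
      (if i = k then int (c (root_vec (Suc d) (i, Suc i))) else 0)"
      using assms by (auto simp: root_vec_def)
  qed
  also have "\<dots> = (if 0 < k then int (c (root_vec (Suc d) (k - 1, k))) else 0) -
    (if k < d then int (c (root_vec (Suc d) (k, Suc k))) else 0)"
    using assms by (auto simp: sum_subtractf sum.delta')
  finally show ?thesis .
qed

definition top_cochar :: "nat \<Rightarrow> nat \<Rightarrow> int vec" where
  "top_cochar n k = vec n (\<lambda>i. if i = n - 1 then int k else 0)"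

lemma top_cochar_minus: "top_cochar n k \<in> cochars_minus n"
  by (auto simp: cochars_minus_iff cochars_def top_cochar_def)

text \<open>Solving coordinate by coordinate, the coefficient at the j-th simple root is the partial
  sum of \<mu> up to \<open>j\<close>. The first of them already forces
  \<open>0 \<le> \<mu> $ 0\<close> (for \<open>n = 1\<close> this is the assumption on the
  determinant), and a nondecreasing \<mu> is then nonnegative throughout.\<close>

lemma cochar_le_top_iff:
  assumes "1 \<le> n" "\<mu> \<in> cochars_minus n" "0 \<le> cochar_det \<mu>"
  shows "cochar_le n \<mu> (top_cochar n (nat (cochar_det \<mu>))) \<longleftrightarrow> \<mu> \<in> Lam n"
proof -
  obtain d where n: "n = Suc d"
    using assms(1) by (cases n) auto
  have \<mu>: "dim_vec \<mu> = Suc d" "\<And>i j. i \<le> j \<Longrightarrow> j < Suc d \<Longrightarrow> \<mu> $ i \<le> \<mu> $ j"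
    using assms(2) by (auto simp: cochars_minus_iff cochars_def n)
  have det: "cochar_det \<mu> = (\<Sum>i<d. \<mu> $ i) + \<mu> $ d"
    using \<mu> by (simp add: cochar_det_def)
  let ?\<kappa> = "top_cochar n (nat (cochar_det \<mu>))"
  have \<kappa>: "?\<kappa> $ k = (if k = d then cochar_det \<mu> else 0)" if "k < Suc d" for k
    using that assms(3) by (simp add: top_cochar_def n)
  have le: "cochar_le n \<mu> ?\<kappa> \<longleftrightarrow> (\<exists>c :: int vec \<Rightarrow> nat. \<forall>k<Suc d. ?\<kappa> $ k - \<mu> $ k =
    (if 0 < k then int (c (root_vec (Suc d) (k - 1, k))) else 0) -
    (if k < d then int (c (root_vec (Suc d) (k, Suc k))) else 0))"
  proof -
    have "?\<kappa> - \<mu> = vec n (\<lambda>k. \<Sum>\<alpha>\<in>simple_roots n. int (c \<alpha>) * (- \<alpha>) $ k) \<longleftrightarrow> (\<forall>k<Suc d. ?\<kappa> $ k - \<mu> $ k =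
      (if 0 < k then int (c (root_vec (Suc d) (k - 1, k))) else 0) -
      (if k < d then int (c (root_vec (Suc d) (k, Suc k))) else 0))" for c :: "int vec \<Rightarrow> nat"
      using \<mu>(1) by (simp only: vec_eq_iff n dim_vec index_minus_vec index_vec sum_simple_roots_index cong: imp_cong)
        (simp add: index_minus_vec)
    then show ?thesis
      by (simp only: cochar_le_def)
  qed
  show ?thesis
  proof
    assume "cochar_le n \<mu> ?\<kappa>"
    then obtain c :: "int vec \<Rightarrow> nat" where "?\<kappa> $ 0 - \<mu> $ 0 =
        - (if 0 < d then int (c (root_vec (Suc d) (0, Suc 0))) else 0)"
      unfolding le by force
    then have "0 \<le> \<mu> $ 0"
      using \<kappa>[of 0] det assms(3) by (auto split: if_splits)
    then have "0 \<le> \<mu> $ i" if "i < n" for i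
      using \<mu>(2)[of 0 i] that by (simp add: n)
    then show "\<mu> \<in> Lam n"
      using assms(2) by (simp add: Lam_def)
  next
    assume "\<mu> \<in> Lam n"
    then have pos: "0 \<le> (\<Sum>i\<le>j. \<mu> $ i)" if "j < d" for j
      using that by (intro sum_nonneg) (auto simp: Lam_def n)
    \<comment> \<open>Coefficients are functions of root vectors, so \<open>inv_into\<close> first
      recovers the position of the simple root.\<close>
    define c where "c \<alpha> = nat (\<Sum>i\<le>inv_into {i. Suc i < Suc d} (\<lambda>i. root_vec (Suc d) (i, Suc i)) \<alpha>. \<mu> $ i)" for \<alpha>
    have c: "int (c (root_vec (Suc d) (j, Suc j))) = (\<Sum>i\<le>j. \<mu> $ i)" if "j < d" for j
      using inv_into_f_f[OF inj_on_simple_root, of j "Suc d"] pos[OF that] that by (simp add: c_def)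
    show "cochar_le n \<mu> ?\<kappa>"
      unfolding le
    proof (intro exI[of _ c] allI impI)
      fix k assume k: "k < Suc d"
      show "?\<kappa> $ k - \<mu> $ k = (if 0 < k then int (c (root_vec (Suc d) (k - 1, k))) else 0) -
        (if k < d then int (c (root_vec (Suc d) (k, Suc k))) else 0)"
      proof (cases k)
        case 0
        with c[of 0] \<kappa>[of 0] det show ?thesis by auto
      next
        case (Suc j)
        with c[of j] c[of k] \<kappa>[OF k] det k show ?thesis
          by (cases "d = Suc j") (auto simp: lessThan_Suc_atMost)
      qed
    qed
  qed
qed


section \<open>Symmetric powers of the standard representation\<close>

abbreviation lkp :: "('a \<Rightarrow>\<^sub>0 'b::zero) \<Rightarrow> 'a \<Rightarrow> 'b" where
  "lkp \<equiv> Poly_Mapping.lookup"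

definition monoms :: "nat \<Rightarrow> nat \<Rightarrow> (nat \<Rightarrow>\<^sub>0 nat) set" where
  "monoms n k = {m. Poly_Mapping.keys m \<subseteq> {..<n} \<and> (\<Sum>i<n. lkp m i) = k}"

lemma Sym_iff: "p \<in> Sym n k \<longleftrightarrow> Poly_Mapping.keys p \<subseteq> monoms n k"
proof -
  have "(\<Sum>i\<in>Poly_Mapping.keys m. lkp m i) = (\<Sum>i<n. lkp m i)" if "Poly_Mapping.keys m \<subseteq> {..<n}" for m
    using that by (intro sum.mono_neutral_left) (auto simp: in_keys_iff)
  then have "Poly_Mapping.keys m \<subseteq> {..<n} \<and> (\<Sum>i\<in>Poly_Mapping.keys m. lkp m i) = k \<longleftrightarrow> m \<in> monoms n k" for m
    by (auto simp: monoms_def)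
  then show ?thesis
    by (simp add: Sym_def subset_eq[of "Poly_Mapping.keys p"])
qed

lemma lookup_monoms_eq_0: "m \<in> monoms n k \<Longrightarrow> n \<le> i \<Longrightarrow> lkp m i = 0"
  using not_in_keys_iff_lookup_eq_zero by (fastforce simp: monoms_def)

lemma single_Suc_0_eq_iff:
  "Poly_Mapping.single i (Suc 0) = Poly_Mapping.single j (Suc 0) \<longleftrightarrow> i = (j :: nat)"
  by (metis lookup_single_eq lookup_single_not_eq nat.distinct(1))

lemma monoms_add: "a \<in> monoms n k \<Longrightarrow> b \<in> monoms n l \<Longrightarrow> a + b \<in> monoms n (k + l)"
  using keys_add[of a b] by (auto simp: monoms_def lookup_add sum.distrib)

lemma monoms_0: "monoms n 0 = {0}"
  by (auto simp: monoms_def in_keys_iff subset_iff intro!: poly_mapping_eqI)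

lemma single_in_monos: "i < n \<Longrightarrow> Poly_Mapping.single i k \<in> monoms n k"
  by (auto simp: monoms_def lookup_single when_def)

lemma monoms_Suc_split:
  assumes "m \<in> monoms n (Suc k)"
  shows "\<exists>a\<in>monoms n (Suc 0). \<exists>b\<in>monoms n k. m = a + b"
proof -
  have "\<exists>i<n. lkp m i \<noteq> 0"
    using assms by (auto simp: monoms_def intro: ccontr)
  then obtain i where i: "i < n" "lkp m i \<noteq> 0" by blast
  define b where "b = m - Poly_Mapping.single i (Suc 0)"
  have m: "m = Poly_Mapping.single i (Suc 0) + b"
    using i by (auto simp: b_def lookup_add lookup_minus lookup_single when_def intro!: poly_mapping_eqI)
  have "b \<in> monoms n k"
  proof -
    have "Poly_Mapping.keys b \<subseteq> Poly_Mapping.keys m"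
      by (auto simp: b_def in_keys_iff lookup_minus)
    then have "Poly_Mapping.keys b \<subseteq> {..<n}"
      using assms by (auto simp: monoms_def)
    moreover have "(\<Sum>j<n. lkp m j) = 1 + (\<Sum>j<n. lkp b j)"
      using i by (simp add: m lookup_add sum.distrib lookup_single when_def)
    ultimately show ?thesis
      using assms by (simp add: monoms_def)
  qed
  with m single_in_monos[OF i(1)] show ?thesis by blast
qed

lemma sum_single: "(\<Sum>a\<in>Poly_Mapping.keys p. Poly_Mapping.single a (lkp p a)) = p"
  by (rule poly_mapping_eqI) (auto simp: lookup_sum lookup_single when_def in_keys_iff)

lemma lookup_times_keys:
  fixes p q :: sym_alg
  shows "lkp (p * q) m = (\<Sum>a\<in>Poly_Mapping.keys p. \<Sum>b\<in>Poly_Mapping.keys q. lkp p a * lkp q b when a + b = m)"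
proof -
  have "p * q = (\<Sum>a\<in>Poly_Mapping.keys p. Poly_Mapping.single a (lkp p a)) *
      (\<Sum>b\<in>Poly_Mapping.keys q. Poly_Mapping.single b (lkp q b))"
    by (simp add: sum_single)
  also have "\<dots> = (\<Sum>a\<in>Poly_Mapping.keys p. \<Sum>b\<in>Poly_Mapping.keys q. Poly_Mapping.single (a + b) (lkp p a * lkp q b))"
    by (simp add: sum_product mult_single)
  finally show ?thesis
    by (simp add: lookup_sum lookup_single)
qed

lemma sym_scale_single: "sym_scale c (Poly_Mapping.single m a) = Poly_Mapping.single m (c * a)"
  by (rule poly_mapping_eqI) (simp add: lookup_single when_def)

lemma sym_scale_mult: "sym_scale c p = Poly_Mapping.single 0 c * p"
  unfolding sym_scale_def by (rule mult_map_scale_conv_mult)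

lemma single_power:
  "Poly_Mapping.single (Poly_Mapping.single j (Suc 0)) (c :: complex) ^ k =
    Poly_Mapping.single (Poly_Mapping.single j k) (c ^ k)"
  by (induction k) (simp_all add: mult_single single_add[symmetric])

lemma prod_single:
  "(\<Prod>j\<in>A. Poly_Mapping.single (a j :: nat \<Rightarrow>\<^sub>0 nat) (c j :: complex)) =
    Poly_Mapping.single (\<Sum>j\<in>A. a j) (\<Prod>j\<in>A. c j)"
  by (induction A rule: infinite_finite_induct) (simp_all add: mult_single)

definition lin_form :: "nat \<Rightarrow> complex mat \<Rightarrow> nat \<Rightarrow> sym_alg" where
  "lin_form n g j = (\<Sum>i<n. sym_scale (g $$ (i, j)) (sym_var i))"

lemma lin_form_eq: "lin_form n g j = (\<Sum>i<n. Poly_Mapping.single (Poly_Mapping.single i (Suc 0)) (g $$ (i, j)))"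
  by (simp add: lin_form_def sym_var_def sym_scale_single)

lemma sym_act_eq:
  assumes "p \<in> Sym n k"
  shows "sym_act n Std g p = (\<Sum>m\<in>Poly_Mapping.keys p. sym_scale (lkp p m) (\<Prod>j<n. lin_form n g j ^ lkp m j))"
  unfolding sym_act_def Std_def id_def lin_form_def[symmetric]
proof (intro sum.cong refl arg_cong[of _ _ "sym_scale _"])
  fix m assume "m \<in> Poly_Mapping.keys p"
  then have "Poly_Mapping.keys m \<subseteq> {..<n}"
    using assms by (auto simp: Sym_iff monoms_def)
  then show "(\<Prod>j\<in>Poly_Mapping.keys m. lin_form n g j ^ lkp m j) = (\<Prod>j<n. lin_form n g j ^ lkp m j)"
    by (intro prod.mono_neutral_left) (auto simp: in_keys_iff)
qed

lemma sym_act_single: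
  assumes "m \<in> monoms n k"
  shows "sym_act n Std g (Poly_Mapping.single m c) = sym_scale c (\<Prod>j<n. lin_form n g j ^ lkp m j)"
proof (cases "c = 0")
  case True
  then show ?thesis
    by (simp add: sym_act_def sym_scale_mult)
next
  case False
  then show ?thesis
    using assms by (subst sym_act_eq[of _ n k]) (auto simp: Sym_iff)
qed

section \<open>Grading and stability of the symmetric powers\<close>

lemma Sym_1: "1 \<in> Sym n 0"
  by (simp add: Sym_iff monoms_0)

lemma Sym_add: "p \<in> Sym n k \<Longrightarrow> q \<in> Sym n k \<Longrightarrow> p + q \<in> Sym n k"
  using keys_add[of p q] by (auto simp: Sym_iff)

lemma Sym_sum: "(\<And>x. x \<in> A \<Longrightarrow> f x \<in> Sym n k) \<Longrightarrow> sum f A \<in> Sym n k"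
  by (induction A rule: infinite_finite_induct) (auto simp: Sym_add, auto simp: Sym_iff)

lemma Sym_scale: "p \<in> Sym n k \<Longrightarrow> sym_scale c p \<in> Sym n k"
  by (auto simp: Sym_iff in_keys_iff subset_iff)

lemma Sym_mult: "p \<in> Sym n k \<Longrightarrow> q \<in> Sym n l \<Longrightarrow> p * q \<in> Sym n (k + l)"
  using keys_mult[of p q] by (fastforce simp: Sym_iff intro: monoms_add)

lemma Sym_power: "p \<in> Sym n k \<Longrightarrow> p ^ l \<in> Sym n (l * k)"
  by (induction l) (auto simp: Sym_1 intro: Sym_mult)

lemma Sym_prod: "(\<And>x. x \<in> A \<Longrightarrow> f x \<in> Sym n (d x)) \<Longrightarrow> finite A \<Longrightarrow> prod f A \<in> Sym n (sum d A)"
  by (induction A rule: infinite_finite_induct) (auto simp: Sym_1 intro: Sym_mult)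

lemma Sym_lin_form: "lin_form n g j \<in> Sym n (Suc 0)"
  unfolding lin_form_eq by (rule Sym_sum) (auto simp: Sym_iff single_in_monos)

lemma Sym_lin_form_prod:
  assumes "m \<in> monoms n k"
  shows "(\<Prod>j<n. lin_form n g j ^ lkp m j) \<in> Sym n k"
proof -
  have "(\<Prod>j<n. lin_form n g j ^ lkp m j) \<in> Sym n (\<Sum>j<n. lkp m j)"
    using Sym_power[OF Sym_lin_form] by (intro Sym_prod) auto
  with assms show ?thesis
    by (simp add: monoms_def)
qed

lemma module_sym_scale: "Modules.module sym_scale"
  using vector_space_sym_scale by (simp add: module_iff_vector_space)

lemma subrep_Sym: "subrep sym_scale (GL n UNIV) (sym_act n Std) (Sym n k)"
proof -
  have "0 \<in> Sym n k"
    by (simp add: Sym_iff)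
  moreover have "sym_act n Std g p \<in> Sym n k" if "p \<in> Sym n k" for g p
    unfolding sym_act_eq[OF that] using that
    by (intro Sym_sum Sym_scale Sym_lin_form_prod) (auto simp: Sym_iff)
  ultimately show ?thesis
    by (auto simp: subrep_def module.subspace_def[OF module_sym_scale] Sym_add Sym_scale)
qed

section \<open>Weights and irreducibility\<close>

lemma sum_single_keys:
  fixes m :: "nat \<Rightarrow>\<^sub>0 nat"
  assumes "Poly_Mapping.keys m \<subseteq> {..<n}"
  shows "(\<Sum>j<n. Poly_Mapping.single j (lkp m j)) = m"
proof -
  have "(\<Sum>j<n. Poly_Mapping.single j (lkp m j)) = (\<Sum>j\<in>Poly_Mapping.keys m. Poly_Mapping.single j (lkp m j))"
    using assms by (intro sum.mono_neutral_right) (auto simp: in_keys_iff)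
  then show ?thesis
    by (simp add: sum_single)
qed

lemma lookup_sym_act_diag:
  assumes "p \<in> Sym n k"
  shows "lkp (sym_act n Std (mat_diag n t) p) m = (\<Prod>j<n. t j ^ lkp m j) * lkp p m"
proof -
  have L: "lin_form n (mat_diag n t) j = Poly_Mapping.single (Poly_Mapping.single j (Suc 0)) (t j)" if "j < n" for j
  proof -
    have "lin_form n (mat_diag n t) j =
        (\<Sum>i<n. if i = j then Poly_Mapping.single (Poly_Mapping.single i (Suc 0)) (t j) else 0)"
      unfolding lin_form_eq using that by (intro sum.cong) (auto simp: mat_diag_def)
    then show ?thesis
      using that by simp
  qed
  have "(\<Prod>j<n. lin_form n (mat_diag n t) j ^ lkp m j) = Poly_Mapping.single m (\<Prod>j<n. t j ^ lkp m j)"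
    if "m \<in> Poly_Mapping.keys p" for m
  proof -
    have "Poly_Mapping.keys m \<subseteq> {..<n}"
      using assms that by (auto simp: Sym_iff monoms_def)
    then show ?thesis
      by (simp add: L single_power prod_single sum_single_keys)
  qed
  then show ?thesis
    unfolding sym_act_eq[OF assms]
    by (simp add: lookup_sum sym_scale_single lookup_single when_def in_keys_iff)
qed

lemma mat_diag_in_lower_borel:
  assumes "\<And>i. i < n \<Longrightarrow> t i \<noteq> 0"
  shows "mat_diag n t \<in> lower_borel n"
proof -
  have "mat_diag n (\<lambda>i. t i * (1 / t i)) = 1\<^sub>m n" "mat_diag n (\<lambda>i. 1 / t i * t i) = 1\<^sub>m n"
    unfolding mat_diag_def using assms by (auto intro!: eq_matI)
  then have "mat_diag n t \<in> GL n UNIV"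
    unfolding GL_def by (auto intro!: bexI[of _ "mat_diag n (\<lambda>i. 1 / t i)"] simp only: mat_diag_diag mat_diag_dim)
  then show ?thesis
    by (auto simp: lower_borel_def mat_diag_def)
qed

lemma two_power_eq_iff: "(2 :: complex) ^ a = 2 ^ b \<longleftrightarrow> a = b"
proof -
  have "(2 :: complex) ^ a = 2 ^ b \<longleftrightarrow> of_nat (2 ^ a) = (of_nat (2 ^ b) :: complex)"
    by (simp only: of_nat_power of_nat_numeral)
  then show ?thesis
    by (simp only: of_nat_eq_iff) simp
qed

text \<open>Separation of weights, by induction on the number of monomials. If \<open>m'\<close> is
  another monomial of \<open>p\<close>, differing from \<open>m\<close> at \<open>i\<close>, let a
  diagonal matrix with entry 2 at \<open>i\<close> act and subtract \<open>2 ^ lkp m' i\<close>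
  times \<open>p\<close>: this kills \<open>m'\<close> and keeps \<open>m\<close>, since the powers
  of 2 are distinct.\<close>

lemma component_in_subrep:
  assumes "subrep sym_scale (GL n UNIV) (sym_act n Std) U" "U \<subseteq> Sym n k"
    and "p \<in> U" "m \<in> Poly_Mapping.keys p"
  shows "Poly_Mapping.single m 1 \<in> U"
  using assms(3,4)
proof (induction "card (Poly_Mapping.keys p)" arbitrary: p rule: less_induct)
  case less
  have closed: "x + y \<in> U" "sym_scale c x \<in> U" if "x \<in> U" "y \<in> U" for x y c
    using assms(1) that by (auto simp: subrep_def module.subspace_def[OF module_sym_scale])
  show ?case
  proof (cases "Poly_Mapping.keys p = {m}")
    case True
    then have "p = Poly_Mapping.single m (lkp p m)"
      using sum_single[of p] by simp
    then have "sym_scale (1 / lkp p m) p = Poly_Mapping.single m 1"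
      using less.prems(2) by (metis in_keys_iff nonzero_divide_eq_eq sym_scale_single)
    with closed less.prems(1) show ?thesis by metis
  next
    case False
    then obtain m' where m': "m' \<in> Poly_Mapping.keys p" "m' \<noteq> m"
      using less.prems(2) by auto
    then obtain i where i: "lkp m i \<noteq> lkp m' i"
      by (metis poly_mapping_eqI)
    have pS: "p \<in> Sym n k"
      using less.prems(1) assms(2) by blast
    then have "m \<in> monoms n k" "m' \<in> monoms n k"
      using m' less.prems(2) by (auto simp: Sym_iff)
    then have "i < n"
      using i lookup_monoms_eq_0 by (metis not_le)
    define t where "t j = (if j = i then 2 else 1 :: complex)" for j
    have t: "(\<Prod>j<n. t j ^ lkp a j) = 2 ^ lkp a i" for a
      using \<open>i < n\<close> by (simp add: t_def if_distrib[of "\<lambda>x. x ^ _"] cong: if_cong)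
    define p' where "p' = sym_act n Std (mat_diag n t) p + sym_scale (- (2 ^ lkp m' i)) p"
    have p': "lkp p' a = (2 ^ lkp a i - 2 ^ lkp m' i) * lkp p a" for a
      by (simp add: p'_def lookup_add lookup_sym_act_diag[OF pS] t algebra_simps)
    have "mat_diag n t \<in> GL n UNIV"
      using mat_diag_in_lower_borel[of n t] by (auto simp: lower_borel_def t_def)
    then have "p' \<in> U"
      unfolding p'_def using assms(1) less.prems(1) closed by (auto simp: subrep_def)
    moreover have "Poly_Mapping.keys p' \<subset> Poly_Mapping.keys p"
      using m' by (auto simp: in_keys_iff p')
    moreover have "m \<in> Poly_Mapping.keys p'"
      using less.prems(2) i by (simp add: in_keys_iff p' two_power_eq_iff)
    ultimately show ?thesis
      using less.hyps by (meson finite_keys psubset_card_mono)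
  qed
qed

text \<open>Nonnegativity of all coefficients excludes cancellation in products, so strict
  positivity on prescribed monomials can be followed through a product of linear forms without
  computing any coefficient.\<close>

definition pos_on :: "sym_alg \<Rightarrow> (nat \<Rightarrow>\<^sub>0 nat) set \<Rightarrow> bool" where
  "pos_on p A \<longleftrightarrow> (\<forall>m. 0 \<le> Re (lkp p m) \<and> Im (lkp p m) = 0) \<and> (\<forall>m\<in>A. 0 < Re (lkp p m))"

lemma pos_on_times:
  assumes "pos_on p A" "pos_on q B" "C \<subseteq> {a + b | a b. a \<in> A \<and> b \<in> B}"
  shows "pos_on (p * q) C"
proof -
  have Im: "Im (lkp p a) = 0" "Im (lkp q a) = 0" for a
    using assms(1,2) by (auto simp: pos_on_def)
  have Re: "Re (lkp (p * q) m) = (\<Sum>a\<in>Poly_Mapping.keys p. \<Sum>b\<in>Poly_Mapping.keys q.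
      if a + b = m then Re (lkp p a) * Re (lkp q b) else 0)" for m
    by (simp add: lookup_times_keys Im when_def if_distrib[of Re] cong: if_cong)
  have nn: "0 \<le> (if a + b = m then Re (lkp p a) * Re (lkp q b) else 0)" for a b m
    using assms(1,2) by (simp add: pos_on_def)
  have "0 \<le> Re (lkp (p * q) m)" for m
    unfolding Re by (intro sum_nonneg nn)
  moreover have "Im (lkp (p * q) m) = 0" for m
    by (simp add: lookup_times_keys Im when_def if_distrib[of Im] cong: if_cong)
  moreover have "0 < Re (lkp (p * q) (a + b))" if "a \<in> A" "b \<in> B" for a b
  proof -
    have ab: "0 < Re (lkp p a)" "0 < Re (lkp q b)"
      using assms that by (auto simp: pos_on_def)
    then have keys: "a \<in> Poly_Mapping.keys p" "b \<in> Poly_Mapping.keys q"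
      by (auto simp: in_keys_iff)
    have "0 < Re (lkp p a) * Re (lkp q b)"
      using ab by simp
    also have "\<dots> \<le> (\<Sum>b'\<in>Poly_Mapping.keys q. if a + b' = a + b then Re (lkp p a) * Re (lkp q b') else 0)"
      using member_le_sum[of b "Poly_Mapping.keys q" "\<lambda>b'. if a + b' = a + b then Re (lkp p a) * Re (lkp q b') else 0"]
        nn[of a _ "a + b"] keys by simp
    also have "\<dots> \<le> Re (lkp (p * q) (a + b))"
      unfolding Re using keys nn by (intro member_le_sum sum_nonneg) auto
    finally show ?thesis .
  qed
  ultimately show ?thesis
    using assms(3) by (auto simp: pos_on_def)
qed

text \<open>\<open>A d\<close> stands for a family of monomials of degree \<open>d\<close> whose
  members each split off one of degree 1. It is used for all monomials in
  \<open>irreducible_Sym\<close> and for the powers of a single variable in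
  \<open>has_highest_weight_Sym\<close>.\<close>

lemma pos_on_prod:
  assumes L: "\<And>j. j \<in> J \<Longrightarrow> pos_on (L j) (A (Suc 0))" and "finite J"
    and "A 0 \<subseteq> {0}" and A: "\<And>d. A (Suc d) \<subseteq> {a + b | a b. a \<in> A (Suc 0) \<and> b \<in> A d}"
  shows "pos_on (\<Prod>j\<in>J. L j ^ e j) (A (\<Sum>j\<in>J. e j))"
  using assms(2) L
proof (induction J rule: finite_induct)
  case empty
  then show ?case
    using assms(3) by (auto simp: pos_on_def lookup_one when_def)
next
  case (insert j J)
  have "pos_on (L j ^ r * (\<Prod>j\<in>J. L j ^ e j)) (A (r + (\<Sum>j\<in>J. e j)))" for r
  proof (induction r)
    case 0
    then show ?case using insert by simp
  next
    case (Suc r)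
    have "pos_on (L j * (L j ^ r * (\<Prod>j\<in>J. L j ^ e j))) (A (Suc (r + (\<Sum>j\<in>J. e j))))"
      using pos_on_times[OF insert.prems Suc.IH, of j] A by simp
    then show ?case
      by (simp add: mult.assoc)
  qed
  with insert show ?case by simp
qed

lemma lookup_lin_form: "lkp (lin_form n g j) m = (\<Sum>i<n. g $$ (i, j) when Poly_Mapping.single i (Suc 0) = m)"
  by (simp add: lin_form_eq lookup_sum lookup_single)

lemma pos_on_lin_form:
  assumes "\<And>i. i < n \<Longrightarrow> Im (g $$ (i, j)) = 0" "\<And>i. i < n \<Longrightarrow> 0 \<le> Re (g $$ (i, j))"
    and "\<And>i. i \<in> I \<Longrightarrow> i < n \<and> 0 < Re (g $$ (i, j))"
  shows "pos_on (lin_form n g j) ((\<lambda>i. Poly_Mapping.single i (Suc 0)) ` I)"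
proof -
  have "lkp (lin_form n g j) (Poly_Mapping.single i (Suc 0)) = g $$ (i, j)" if "i < n" for i
    unfolding lookup_lin_form using that by (simp add: when_def single_Suc_0_eq_iff)
  moreover have "0 \<le> Re (lkp (lin_form n g j) m) \<and> Im (lkp (lin_form n g j) m) = 0" for m
    unfolding lookup_lin_form using assms(1,2) by (auto simp: when_def intro!: sum_nonneg sum.neutral)
  ultimately show ?thesis
    using assms(3) by (auto simp: pos_on_def)
qed

lemma monoms_1: "monoms n (Suc 0) = (\<lambda>i. Poly_Mapping.single i (Suc 0)) ` {..<n}"
proof (intro equalityI subsetI)
  fix m assume m: "m \<in> monoms n (Suc 0)"
  then have "\<exists>i<n. lkp m i \<noteq> 0"
    by (auto simp: monoms_def intro: ccontr)
  then obtain i where i: "i < n" "lkp m i \<noteq> 0" by blast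
  have sum: "(\<Sum>j<n. lkp m j) = lkp m i + (\<Sum>j\<in>{..<n} - {i}. lkp m j)"
    using i by (simp add: sum.remove)
  then have *: "lkp m i = 1" "(\<Sum>j\<in>{..<n} - {i}. lkp m j) = 0"
    using m i(2) by (simp_all only: monoms_def mem_Collect_eq) linarith+
  have "lkp m j = lkp (Poly_Mapping.single i (Suc 0)) j" for j
  proof (cases "j = i")
    case False
    then show ?thesis
      using *(2) lookup_monoms_eq_0[OF m, of j] by (cases "j < n") (auto simp: lookup_single)
  qed (use * in simp)
  then have "m = Poly_Mapping.single i (Suc 0)"
    by (rule poly_mapping_eqI)
  with i show "m \<in> (\<lambda>i. Poly_Mapping.single i (Suc 0)) ` {..<n}" by blast
qed (auto simp: single_in_monos)

text \<open>The matrix is the identity plus the all-ones matrix \<open>J\<close>. As the square of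
  \<open>J\<close> is \<open>n\<close> times \<open>J\<close>, the matrices \<open>M a\<close>,
  identity plus \<open>a\<close> times \<open>J\<close>, are closed under products and the inverse
  can be sought among them.\<close>

lemma positive_matrix_in_GL: "mat n n (\<lambda>(i, j). if i = j then 2 else 1) \<in> GL n (UNIV :: complex set)"
proof -
  define M where "M a = mat n n (\<lambda>(i, j). (if i = j then 1 else 0) + a :: complex)" for a
  have mult: "M a * M b = M (a + b + of_nat n * a * b)" for a b
  proof (rule eq_matI)
    fix i j assume "i < dim_row (M (a + b + of_nat n * a * b))" "j < dim_col (M (a + b + of_nat n * a * b))"
    then have ij: "i < n" "j < n"
      by (auto simp: M_def)
    have "(M a * M b) $$ (i, j) = (\<Sum>l<n. ((if i = l then 1 else 0) + a) * ((if l = j then 1 else 0) + b))"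
      using ij by (simp add: M_def scalar_prod_def lessThan_atLeast0)
    also have "\<dots> = (\<Sum>l<n. (if l = i then (if i = j then 1 else 0) + b else 0) + (if l = j then a else 0) + a * b)"
      by (intro sum.cong) (auto simp: algebra_simps)
    also have "\<dots> = M (a + b + of_nat n * a * b) $$ (i, j)"
      using ij by (simp add: sum.distrib M_def)
    finally show "(M a * M b) $$ (i, j) = M (a + b + of_nat n * a * b) $$ (i, j)" .
  qed (auto simp: M_def)
  \<comment> \<open>The solution of \<open>1 + c + n * c = 0\<close>, which turns the product of
    \<open>M 1\<close> and \<open>M c\<close> into \<open>M 0\<close>.\<close>
  define c where "c = - (1 / (of_nat (Suc n)) :: complex)"
  have "of_nat (Suc n) * c = - 1"
    unfolding c_def by (simp del: of_nat_Suc)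
  then have "1 + c + of_nat n * 1 * c = 0" "c + 1 + of_nat n * c * 1 = 0"
    by (auto simp: algebra_simps)
  moreover have "M 0 = 1\<^sub>m n"
    by (auto simp: M_def)
  ultimately have inv: "M 1 * M c = 1\<^sub>m n" "M c * M 1 = 1\<^sub>m n"
    unfolding mult by simp_all
  have "M a \<in> carrier_mat n n" for a
    by (simp add: M_def)
  with inv have "M 1 \<in> GL n UNIV"
    unfolding GL_def by blast
  moreover have "M 1 = mat n n (\<lambda>(i, j). if i = j then 2 else 1)"
    by (auto simp: M_def)
  ultimately show ?thesis
    by simp
qed

text \<open>A nonzero \<open>U\<close> contains a monomial by \<open>component_in_subrep\<close>. A
  matrix with positive entries maps it to an element in which every monomial of degree
  \<open>k\<close> occurs, and a second use of \<open>component_in_subrep\<close> puts all of them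
  into \<open>U\<close>.\<close>

lemma irreducible_Sym:
  assumes "1 \<le> n"
  shows "irreducible_rep sym_scale (GL n UNIV) (sym_act n Std) (Sym n k)"
  unfolding irreducible_rep_def
proof (intro conjI allI impI)
  show "subrep sym_scale (GL n UNIV) (sym_act n Std) (Sym n k)"
    by (rule subrep_Sym)
  have "Poly_Mapping.single (Poly_Mapping.single 0 k) 1 \<in> Sym n k"
    using assms by (simp add: Sym_iff single_in_monos)
  moreover have "Poly_Mapping.single (Poly_Mapping.single 0 k) (1 :: complex) \<noteq> 0"
    by (metis lookup_single_eq lookup_zero zero_neq_one)
  ultimately show "Sym n k \<noteq> {0}"
    by blast
next
  fix U assume U: "subrep sym_scale (GL n UNIV) (sym_act n Std) U \<and> U \<subseteq> Sym n k"
  then have sub: "module.subspace sym_scale U"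
    by (simp add: subrep_def)
  show "U = {0} \<or> U = Sym n k"
  proof (cases "U = {0}")
    case False
    moreover have "0 \<in> U"
      using sub by (simp add: module.subspace_def[OF module_sym_scale])
    ultimately obtain p where p: "p \<in> U" "p \<noteq> 0" by blast
    then obtain m where m: "m \<in> Poly_Mapping.keys p"
      by (metis all_not_in_conv keys_eq_empty)
    have "p \<in> Sym n k"
      using p(1) U by blast
    with m have mono: "m \<in> monoms n k"
      by (auto simp: Sym_iff)
    define g where "g = mat n n (\<lambda>(i, j). if i = j then 2 else 1 :: complex)"
    define q where "q = sym_act n Std g (Poly_Mapping.single m 1)"
    have "Poly_Mapping.single m 1 \<in> U"
      using component_in_subrep U p(1) m by blast
    then have "q \<in> U"
      using U positive_matrix_in_GL[of n] by (auto simp: subrep_def q_def g_def)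
    have q: "q = (\<Prod>j<n. lin_form n g j ^ lkp m j)"
      unfolding q_def sym_act_single[OF mono] by (simp add: sym_scale_mult)
    have "pos_on q (monoms n (\<Sum>j<n. lkp m j))"
      unfolding q
    proof (rule pos_on_prod)
      show "pos_on (lin_form n g j) (monoms n (Suc 0))" if "j \<in> {..<n}" for j
        unfolding monoms_1 using that by (intro pos_on_lin_form) (auto simp: g_def)
      show "monoms n (Suc d) \<subseteq> {a + b |a b. a \<in> monoms n (Suc 0) \<and> b \<in> monoms n d}" for d
        using monoms_Suc_split by blast
    qed (auto simp: monoms_0)
    moreover have "(\<Sum>j<n. lkp m j) = k"
      using mono by (simp add: monoms_def)
    ultimately have "0 < Re (lkp q a)" if "a \<in> monoms n k" for a
      using that by (simp add: pos_on_def)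
    then have keys: "monoms n k \<subseteq> Poly_Mapping.keys q"
      by (metis in_keys_iff less_irrefl subsetI zero_complex.sel(1))
    have "x \<in> U" if "x \<in> Sym n k" for x
    proof -
      have "sym_scale (lkp x a) (Poly_Mapping.single a 1) \<in> U" if "a \<in> Poly_Mapping.keys x" for a
      proof -
        have "Poly_Mapping.single a 1 \<in> U"
          using component_in_subrep[of n U k q a] U \<open>q \<in> U\<close> keys that \<open>x \<in> Sym n k\<close> by (auto simp: Sym_iff)
        then show ?thesis
          using sub by (simp add: module.subspace_def[OF module_sym_scale])
      qed
      then have "(\<Sum>a\<in>Poly_Mapping.keys x. sym_scale (lkp x a) (Poly_Mapping.single a 1)) \<in> U"
        by (intro module.subspace_sum[OF module_sym_scale sub])
      then show ?thesis
        by (simp add: sym_scale_single sum_single)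
    qed
    with U show ?thesis by blast
  qed simp
qed

text \<open>This element adds the last basis vector to every other one. It lies in a one-parameter
  group, \<open>M a * M b = M (a + b)\<close>, which provides the inverse.\<close>

lemma unipotent_in_lower_borel:
  "mat (Suc d) (Suc d) (\<lambda>(i, j). if i = j \<or> i = d then 1 else 0) \<in> lower_borel (Suc d)"
proof -
  define M where "M a = mat (Suc d) (Suc d) (\<lambda>(i, j). if i = j then 1 else if i = d then a else 0 :: complex)" for a
  have mult: "M a * M b = M (a + b)" for a b
  proof (rule eq_matI)
    fix i j assume "i < dim_row (M (a + b))" "j < dim_col (M (a + b))"
    then have ij: "i < Suc d" "j < Suc d"
      by (auto simp: M_def)
    have "(M a * M b) $$ (i, j) = (\<Sum>l<Suc d. (if i = l then 1 else if i = d then a else 0) *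
        (if l = j then 1 else if l = d then b else 0))"
      using ij by (simp add: M_def scalar_prod_def lessThan_atLeast0 del: sum.lessThan_Suc sum.op_ivl_Suc)
    also have "\<dots> = (\<Sum>l<d. if l = j then if i = l then 1 else if i = d then a else 0 else 0) +
        (if i = d then if d = j then 1 else b else 0)"
    proof -
      have "(\<Sum>l<d. (if i = l then 1 else if i = d then a else 0) * (if l = j then 1 else if l = d then b else 0)) =
          (\<Sum>l<d. if l = j then if i = l then 1 else if i = d then a else 0 else 0)"
        by (intro sum.cong) auto
      then show ?thesis by simp
    qed
    also have "\<dots> = M (a + b) $$ (i, j)"
      using ij by (auto simp: M_def)
    finally show "(M a * M b) $$ (i, j) = M (a + b) $$ (i, j)" .
  qed (auto simp: M_def)
  have "M 0 = 1\<^sub>m (Suc d)"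
    by (auto simp: M_def)
  then have inv: "M 1 * M (- 1) = 1\<^sub>m (Suc d)" "M (- 1) * M 1 = 1\<^sub>m (Suc d)"
    unfolding mult by simp_all
  have "M a \<in> carrier_mat (Suc d) (Suc d)" for a
    by (simp add: M_def)
  with inv have "M 1 \<in> GL (Suc d) UNIV"
    unfolding GL_def by blast
  moreover have "M 1 = mat (Suc d) (Suc d) (\<lambda>(i, j). if i = j \<or> i = d then 1 else 0)"
    by (auto simp: M_def)
  ultimately show ?thesis
    by (auto simp: lower_borel_def)
qed

text \<open>For uniqueness, the torus forces every monomial of the eigenvector to have exponents
  \<kappa>, so the vector is a multiple of one monomial. The unipotent element above fixes it, yet
  the image has a nonzero coefficient at the k-th power of the last variable; so the monomial is
  that power.\<close>

lemma has_highest_weight_Sym: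
  assumes "1 \<le> n" "\<kappa> \<in> cochars n"
  shows "has_highest_weight n sym_scale (sym_act n Std) \<kappa> (Sym n k) \<longleftrightarrow> \<kappa> = top_cochar n k"
proof -
  obtain d where n: "n = Suc d"
    using assms(1) by (cases n) auto
  have dn: "d < n"
    by (simp add: n)
  let ?top = "Poly_Mapping.single d k"
  have top: "?top \<in> monoms n k"
    by (simp add: n single_in_monos)
  show ?thesis
  proof
    assume \<kappa>: "\<kappa> = top_cochar n k"
    have act: "sym_act n Std b (Poly_Mapping.single ?top 1) =
        sym_scale (\<Prod>i<n. (b $$ (i, i)) powi (\<kappa> $ i)) (Poly_Mapping.single ?top 1)"
      if b: "b \<in> lower_borel n" for b
    proof -
      have "lin_form n b d = (\<Sum>i<n. if i = d then Poly_Mapping.single (Poly_Mapping.single i (Suc 0)) (b $$ (i, i)) else 0)"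
        unfolding lin_form_eq using b by (intro sum.cong) (auto simp: lower_borel_def n)
      then have L: "lin_form n b d = Poly_Mapping.single (Poly_Mapping.single d (Suc 0)) (b $$ (d, d))"
        by (simp add: n)
      have "(\<Prod>j<n. lin_form n b j ^ lkp ?top j) = (\<Prod>j<n. if j = d then lin_form n b d ^ k else 1)"
        by (intro prod.cong) (auto simp: lookup_single)
      also have "\<dots> = Poly_Mapping.single ?top ((b $$ (d, d)) ^ k)"
        using dn by (simp add: L single_power)
      finally have "sym_act n Std b (Poly_Mapping.single ?top 1) = Poly_Mapping.single ?top ((b $$ (d, d)) ^ k)"
        unfolding sym_act_single[OF top] by (simp add: sym_scale_mult)
      moreover have "(\<Prod>i<n. (b $$ (i, i)) powi (\<kappa> $ i)) = (\<Prod>i<n. if i = d then (b $$ (d, d)) ^ k else 1)"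
        by (intro prod.cong) (auto simp: \<kappa> top_cochar_def n)
      ultimately show ?thesis
        by (simp add: n sym_scale_single)
    qed
    show "has_highest_weight n sym_scale (sym_act n Std) \<kappa> (Sym n k)"
      unfolding has_highest_weight_def
    proof (intro bexI conjI ballI)
      show "Poly_Mapping.single ?top (1 :: complex) \<noteq> 0"
        by (metis lookup_single_eq lookup_zero zero_neq_one)
      show "Poly_Mapping.single ?top 1 \<in> Sym n k"
        using top by (simp add: Sym_iff)
    qed (rule act)
  next
    assume "has_highest_weight n sym_scale (sym_act n Std) \<kappa> (Sym n k)"
    then obtain x where x: "x \<in> Sym n k" "x \<noteq> 0" and
      act: "\<And>b. b \<in> lower_borel n \<Longrightarrow> sym_act n Std b x = sym_scale (\<Prod>i<n. (b $$ (i, i)) powi (\<kappa> $ i)) x"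
      unfolding has_highest_weight_def by blast
    have weight: "int (lkp m i) = \<kappa> $ i" if m: "m \<in> Poly_Mapping.keys x" and i: "i < n" for m i
    proof -
      define t where "t j = (if j = i then 2 else 1 :: complex)" for j
      have "mat_diag n t \<in> lower_borel n"
        by (rule mat_diag_in_lower_borel) (simp add: t_def)
      then have "lkp (sym_act n Std (mat_diag n t) x) m =
          (\<Prod>j<n. (mat_diag n t $$ (j, j)) powi (\<kappa> $ j)) * lkp x m"
        by (simp only: act lookup_sym_scale)
      also have "(\<Prod>j<n. (mat_diag n t $$ (j, j)) powi (\<kappa> $ j)) = (\<Prod>j<n. if j = i then 2 powi (\<kappa> $ i) else 1)"
        by (intro prod.cong) (auto simp: mat_diag_def t_def)
      also have "\<dots> = 2 powi (\<kappa> $ i)"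
        using i by simp
      also have "lkp (sym_act n Std (mat_diag n t) x) m = (\<Prod>j<n. t j ^ lkp m j) * lkp x m"
        by (rule lookup_sym_act_diag[OF x(1)])
      also have "(\<Prod>j<n. t j ^ lkp m j) = (\<Prod>j<n. if j = i then 2 ^ lkp m i else 1)"
        by (intro prod.cong) (auto simp: t_def)
      also have "\<dots> = 2 ^ lkp m i"
        using i by simp
      finally have "2 ^ lkp m i = (2 powi (\<kappa> $ i) :: complex)"
        using m by (simp add: in_keys_iff)
      \<comment> \<open>Norms move the equation to the reals, where injectivity of
        \<open>powr\<close> compares the natural exponent with the integer one.\<close>
      then have "norm (2 ^ lkp m i :: complex) = norm (2 powi (\<kappa> $ i) :: complex)"
        by simp
      then have "(2 :: real) powi int (lkp m i) = 2 powi (\<kappa> $ i)"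
        by (simp add: norm_power norm_power_int)
      then have "(2 :: real) powr real_of_int (int (lkp m i)) = 2 powr real_of_int (\<kappa> $ i)"
        by (simp add: powr_real_of_int' del: of_int_of_nat_eq)
      then show ?thesis
        by (simp only: powr_inj of_int_eq_iff)
    qed
    obtain m where m: "m \<in> Poly_Mapping.keys x"
      using x(2) by (metis all_not_in_conv keys_eq_empty)
    have mono: "a \<in> monoms n k" if "a \<in> Poly_Mapping.keys x" for a
      using x(1) that by (auto simp: Sym_iff)
    have "a = m" if "a \<in> Poly_Mapping.keys x" for a
    proof (rule poly_mapping_eqI)
      fix i
      show "lkp a i = lkp m i"
      proof (cases "i < n")
        case True
        then show ?thesis
          using weight[OF m True] weight[OF that True] by simp
      next
        case False
        then show ?thesis
          using lookup_monoms_eq_0[OF mono[OF m], of i] lookup_monoms_eq_0[OF mono[OF that], of i] by simp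
      qed
    qed
    then have "Poly_Mapping.keys x = {m}"
      using m by blast
    then have xm: "x = Poly_Mapping.single m (lkp x m)"
      using sum_single[of x] by simp
    define b where "b = mat n n (\<lambda>(i, j). if i = j \<or> i = d then 1 else 0 :: complex)"
    have "b \<in> lower_borel n"
      using unipotent_in_lower_borel[of d] by (simp add: b_def n)
    then have "sym_act n Std b x = sym_scale (\<Prod>i<n. (b $$ (i, i)) powi (\<kappa> $ i)) x"
      by (rule act)
    also have "\<dots> = x"
      by (simp add: b_def sym_scale_mult)
    finally have "sym_scale (lkp x m) (\<Prod>j<n. lin_form n b j ^ lkp m j) = x"
      using sym_act_single[OF mono[OF m], of b "lkp x m"] xm by simp
    moreover have "pos_on (\<Prod>j<n. lin_form n b j ^ lkp m j) {Poly_Mapping.single d (\<Sum>j<n. lkp m j)}"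
    proof (rule pos_on_prod[where A = "\<lambda>k. {Poly_Mapping.single d k}"])
      show "pos_on (lin_form n b j) {Poly_Mapping.single d (Suc 0)}" if "j \<in> {..<n}" for j
        using pos_on_lin_form[of n b j "{d}"] that by (simp add: b_def n)
      show "{Poly_Mapping.single d (Suc e)} \<subseteq>
          {a + b |a b. a \<in> {Poly_Mapping.single d (Suc 0)} \<and> b \<in> {Poly_Mapping.single d e}}" for e
        by (simp add: single_add[symmetric])
    qed auto
    moreover have "(\<Sum>j<n. lkp m j) = k"
      using mono[OF m] by (simp add: monoms_def)
    ultimately have x_eq: "sym_scale (lkp x m) (\<Prod>j<n. lin_form n b j ^ lkp m j) = x"
      and "pos_on (\<Prod>j<n. lin_form n b j ^ lkp m j) {?top}"
      by simp_all
    then have "lkp (\<Prod>j<n. lin_form n b j ^ lkp m j) ?top \<noteq> 0"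
      by (auto simp: pos_on_def)
    with m have "lkp (sym_scale (lkp x m) (\<Prod>j<n. lin_form n b j ^ lkp m j)) ?top \<noteq> 0"
      by (simp add: in_keys_iff)
    then have "lkp x ?top \<noteq> 0"
      by (simp only: x_eq not_False_eq_True)
    then have "m = ?top"
      using \<open>Poly_Mapping.keys x = {m}\<close> by (metis in_keys_iff singletonD)
    then have "\<kappa> $ i = top_cochar n k $ i" if "i < n" for i
      using weight[OF m that] that by (auto simp: top_cochar_def n lookup_single)
    then show "\<kappa> = top_cochar n k"
      using assms(2) by (intro eq_vecI) (auto simp: cochars_def top_cochar_def)
  qed
qed

text \<open>Makes the \<open>THE\<close> in \<open>mult_V\<close> well defined for irreducible
  \<open>W\<close>. Each summand is a nonzero subrepresentation of \<open>W\<close>, hence all of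
  \<open>W\<close>; with two summands, \<open>w\<close> and \<open>- w\<close> in the first two
  places would contradict independence.\<close>

lemma direct_sum_irreducible_iff:
  assumes s: "Modules.module s" and W: "irreducible_rep s G act W"
  shows "is_direct_sum Ws W \<and> (\<forall>U\<in>set Ws. irreducible_rep s G act U) \<longleftrightarrow> Ws = [W]"
proof
  assume *: "is_direct_sum Ws W \<and> (\<forall>U\<in>set Ws. irreducible_rep s G act U)"
  then have eq: "W = {\<Sum>i<length Ws. x i | x. \<forall>i<length Ws. x i \<in> Ws ! i}"
    and indep: "\<And>x. (\<forall>i<length Ws. x i \<in> Ws ! i) \<Longrightarrow> (\<Sum>i<length Ws. x i) = 0 \<Longrightarrow> (\<forall>i<length Ws. x i = 0)"
    by (simp_all add: is_direct_sum_def)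
  have irr: "irreducible_rep s G act (Ws ! i)" if "i < length Ws" for i
    using * that by simp
  have zero: "0 \<in> Ws ! i" if "i < length Ws" for i
    using irr[OF that] by (auto simp: irreducible_rep_def subrep_def module.subspace_def[OF s])
  have all: "Ws ! i = W" if i: "i < length Ws" for i
  proof -
    have "Ws ! i \<subseteq> W"
    proof
      fix w assume "w \<in> Ws ! i"
      then have "\<forall>j<length Ws. (if j = i then w else 0) \<in> Ws ! j"
        using zero by simp
      then have "(\<Sum>j<length Ws. if j = i then w else 0) \<in> W"
        by (subst eq) blast
      with i show "w \<in> W" by simp
    qed
    with irr[OF i] W show ?thesis
      by (auto simp: irreducible_rep_def)
  qed
  have "0 \<in> W" "W \<noteq> {0}"
    using W by (auto simp: irreducible_rep_def subrep_def module.subspace_def[OF s])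
  then obtain w where w: "w \<in> W" "w \<noteq> 0"
    by blast
  have "length Ws \<noteq> 0"
  proof
    assume "length Ws = 0"
    with eq have "W = {0}" by simp
    with w show False by simp
  qed
  moreover have "\<not> 2 \<le> length Ws"
  proof
    assume two: "2 \<le> length Ws"
    define x where "x i = (if i = 0 then w else if i = Suc 0 then - w else 0)" for i :: nat
    have "- w \<in> W"
      using W w module.subspace_neg[OF s] by (auto simp: irreducible_rep_def subrep_def)
    then have "\<forall>i<length Ws. x i \<in> Ws ! i"
      using w zero all by (auto simp: x_def)
    moreover have "(\<Sum>i<length Ws. x i) = (\<Sum>i<2. x i)"
      using two by (intro sum.mono_neutral_right) (auto simp: x_def)
    then have "(\<Sum>i<length Ws. x i) = 0"
      by (simp add: x_def numeral_2_eq_2)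
    ultimately have "\<forall>i<length Ws. x i = 0"
      by (rule indep)
    then have "x 0 = 0"
      using two by (metis gr0I not_numeral_le_zero)
    with w show False
      by (simp add: x_def)
  qed
  ultimately have "length Ws = 1"
    by linarith
  with all[of 0] show "Ws = [W]"
    by (auto simp: length_Suc_conv)
next
  assume Ws: "Ws = [W]"
  have "W = {x 0 | x. x 0 \<in> W}" for W :: "'a set"
    by (auto intro: exI[of _ "\<lambda>_. _"])
  with W show "is_direct_sum Ws W \<and> (\<forall>U\<in>set Ws. irreducible_rep s G act U)"
    by (simp add: Ws is_direct_sum_def)
qed

lemma mult_V_Sym:
  assumes "1 \<le> n" "\<kappa> \<in> cochars n"
  shows "mult_V n sym_scale (sym_act n Std) (Sym n k) \<kappa> = (if \<kappa> = top_cochar n k then 1 else 0)"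
proof -
  let ?V = "is_V n sym_scale (sym_act n Std) \<kappa>"
  note irr = irreducible_Sym[OF assms(1), of k]
  have "mult_V n sym_scale (sym_act n Std) (Sym n k) \<kappa> = (THE m. m = length (filter ?V [Sym n k]))"
    unfolding mult_V_def conj_assoc[symmetric] direct_sum_irreducible_iff[OF module_sym_scale irr]
    by (simp only: simp_thms)
  then show ?thesis
    using irr by (simp add: is_V_def has_highest_weight_Sym[OF assms])
qed


section \<open>The basic function\<close>

lemma basic_coeff_eq:
  assumes n: "1 \<le> n" and \<mu>: "\<mu> \<in> cochars_minus n"
  shows "basic_coeff n \<mu> q =
    (if \<mu> \<in> Lam n then inverse q ^ (\<Sum>i<n. (n - 1 - i) * nat (\<mu> $ i)) else 0)"
proof (cases "0 \<le> cochar_det \<mu>")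
  case False
  have "\<mu> \<notin> Lam n"
  proof
    assume "\<mu> \<in> Lam n"
    then have "0 \<le> cochar_det \<mu>"
      unfolding cochar_det_def by (intro sum_nonneg) (auto simp: Lam_iff cochars_def)
    with False show False by simp
  qed
  with False show ?thesis
    by (simp add: basic_coeff_def)
next
  case True
  let ?top = "top_cochar n (nat (cochar_det \<mu>))"
  let ?f = "\<lambda>\<kappa>. kostka_foulkes n \<kappa> \<mu> (inverse q) when cochar_le n \<mu> \<kappa>"
  have "((kostka_foulkes n \<kappa> \<mu> (inverse q) *
      real (mult_V n sym_scale (sym_act n Std) (Sym n (nat (cochar_det \<mu>))) \<kappa>))
      when (\<kappa> \<in> cochars_minus n \<and> cochar_le n \<mu> \<kappa>)) = (?f \<kappa> when \<kappa> = ?top)" for \<kappa>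
  proof (cases "\<kappa> \<in> cochars_minus n")
    case True
    then have "\<kappa> \<in> cochars n"
      by (simp add: cochars_minus_iff)
    with True show ?thesis
      by (auto simp: mult_V_Sym[OF n] when_def)
  next
    case False
    then show ?thesis
      using top_cochar_minus by (auto simp: when_def)
  qed
  then have "basic_coeff n \<mu> q = ?f ?top"
    using True by (simp add: basic_coeff_def)
  also have "\<dots> = (kostka_foulkes n ?top \<mu> (inverse q) when \<mu> \<in> Lam n)"
    by (simp add: cochar_le_top_iff[OF n \<mu> True])
  also have "\<dots> = (if \<mu> \<in> Lam n then inverse q ^ (\<Sum>i<n. (n - 1 - i) * nat (\<mu> $ i)) else 0)"
  proof (cases "\<mu> \<in> Lam n")
    case Lam: True
    obtain d where d: "n = Suc d"
      using n by (cases n) auto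
    have nn: "0 \<le> \<mu> $ i" if "i < n" for i
      using Lam that by (auto simp: Lam_iff)
    have "nat (cochar_det \<mu>) = (\<Sum>i<Suc d. nat (\<mu> $ i))"
    proof -
      have "cochar_det \<mu> = (\<Sum>i<Suc d. int (nat (\<mu> $ i)))"
        using Lam nn unfolding cochar_det_def by (intro sum.cong) (auto simp: Lam_iff cochars_def d)
      then show ?thesis
        by (simp only: of_nat_sum[symmetric] nat_int)
    qed
    then have "kostka_foulkes (Suc d) (top_cochar (Suc d) (nat (cochar_det \<mu>))) \<mu> (inverse q) =
        inverse q ^ (\<Sum>i<Suc d. (d - i) * nat (\<mu> $ i))"
      using Lam nn top_cochar_minus[of n "nat (cochar_det \<mu>)"]
      by (intro kostka_foulkes_one_row) (auto simp: Lam_iff cochars_minus_iff d top_cochar_def)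
    with Lam show ?thesis
      by (simp add: d del: sum.lessThan_Suc)
  qed simp
  finally show ?thesis .
qed

lemma rho_minus_scalar_prod:
  assumes "\<mu> \<in> cochars n"
  shows "rho_minus n \<bullet> map_vec of_int \<mu> = (\<Sum>i<n. (real i - (real n - 1) / 2) * of_int (\<mu> $ i))"
  using assms by (auto simp: scalar_prod_def cochars_def rho_minus_index lessThan_atLeast0 intro!: sum.cong)

text \<open>The exponents add up coordinatewise: \<open>- (n - 1 - i)\<close> from the coefficient
  and \<open>- (i - (n - 1) / 2)\<close> from the pairing give \<open>- (n - 1) / 2\<close> for
  every \<open>i\<close>.\<close>

lemma basic_coeff_powr:
  assumes "1 \<le> n" "\<mu> \<in> Lam n" "0 < q"
  shows "basic_coeff n \<mu> q * q powr (- (rho_minus n \<bullet> map_vec of_int \<mu>)) =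
    q powr (- ((real n - 1) / 2) * of_int (cochar_det \<mu>))"
proof -
  have \<mu>: "\<mu> \<in> cochars_minus n" "\<mu> \<in> cochars n" "\<And>i. i < n \<Longrightarrow> 0 \<le> \<mu> $ i" "dim_vec \<mu> = n"
    using assms(2) by (auto simp: Lam_iff cochars_minus_iff cochars_def)
  define N where "N = (\<Sum>i<n. (n - 1 - i) * nat (\<mu> $ i))"
  have N: "real N = (\<Sum>i<n. (real n - 1 - real i) * of_int (\<mu> $ i))"
    unfolding N_def of_nat_sum using \<mu>(3) assms(1)
    by (intro sum.cong) (auto simp: of_nat_diff)
  have coeff: "basic_coeff n \<mu> q = inverse q ^ N"
    using assms(1,2) \<mu>(1) by (simp only: basic_coeff_eq N_def if_True)
  have "basic_coeff n \<mu> q * q powr (- (rho_minus n \<bullet> map_vec of_int \<mu>)) =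
      q powr (- real N + - (rho_minus n \<bullet> map_vec of_int \<mu>))"
    unfolding powr_add coeff using assms(3) by (simp add: powr_minus powr_realpow power_inverse)
  also have "- real N + - (rho_minus n \<bullet> map_vec of_int \<mu>) = - ((real n - 1) / 2) * of_int (cochar_det \<mu>)"
    unfolding N rho_minus_scalar_prod[OF \<mu>(2)] cochar_det_def \<mu>(4) of_int_sum sum_distrib_left
      sum_negf[symmetric] sum.distrib[symmetric]
    by (intro sum.cong) (auto simp: field_simps)
  finally show ?thesis .
qed

lemma (in nonarch_local_field) residue_card_pos: "0 < residue_card v"
proof -
  have "0 \<in> val_ring v"
    by (simp add: val_ring_def frac_ideal_def)
  then have "residue_field v \<noteq> {}"
    by (auto simp: residue_field_def quotient_def)
  with finite_residue_field show ?thesis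
    by (simp add: residue_card_def card_gt_0_iff)
qed

theorem theorem6p1p3:
  fixes n :: nat and v :: "'a::field \<Rightarrow> int" and \<pi> :: 'a
  assumes "1 \<le> n"
    and "nonarch_local_field v"
    and "is_uniformizer v \<pi>"
  shows "Lam n = {\<mu> \<in> cochars n. (\<forall>i<n. 0 \<le> \<mu> $ i) \<and> (\<forall>i j. i \<le> j \<and> j < n \<longrightarrow> \<mu> $ i \<le> \<mu> $ j)} \<and>
    (\<forall>g \<in> GL n UNIV. basic_function n v \<pi> g =
      Sum_any (\<lambda>\<mu>. Polynomial.monom
          (of_real (real (residue_card v) powr (- ((real n - 1) / 2) * real_of_int (cochar_det \<mu>))) *
           indicator (double_coset (GL n (val_ring v)) (cochar_eval n \<mu> \<pi>)) g)
          (nat (cochar_det \<mu>))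
        when \<mu> \<in> Lam n))"
proof (intro conjI ballI)
  show "Lam n = {\<mu> \<in> cochars n. (\<forall>i<n. 0 \<le> \<mu> $ i) \<and> (\<forall>i j. i \<le> j \<and> j < n \<longrightarrow> \<mu> $ i \<le> \<mu> $ j)}"
    by (rule Set.set_eqI) (simp only: Lam_iff mem_Collect_eq)
next
  fix g :: "'a mat"
  let ?q = "real (residue_card v)"
  let ?D = "\<lambda>\<mu>. indicator (double_coset (GL n (val_ring v)) (cochar_eval n \<mu> \<pi>)) g :: complex"
  have q: "0 < ?q"
    using nonarch_local_field.residue_card_pos[OF assms(2)] by simp
  have "(Polynomial.monom (of_real (basic_coeff n \<mu> ?q * ?q powr (- (rho_minus n \<bullet> map_vec of_int \<mu>))) * ?D \<mu>)
        (nat (cochar_det \<mu>)) when \<mu> \<in> cochars_minus n) =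
      (Polynomial.monom (of_real (?q powr (- ((real n - 1) / 2) * real_of_int (cochar_det \<mu>))) * ?D \<mu>)
        (nat (cochar_det \<mu>)) when \<mu> \<in> Lam n)" for \<mu>
  proof (cases "\<mu> \<in> Lam n")
    case True
    then have "\<mu> \<in> cochars_minus n"
      by (simp add: Lam_def)
    with True show ?thesis
      by (simp only: basic_coeff_powr[OF assms(1) True q])
  next
    \<comment> \<open>Here the left side vanishes too: \<mu> is either outside
      \<open>cochars_minus n\<close> or has coefficient 0 by \<open>basic_coeff_eq\<close>.\<close>
    case False
    then show ?thesis
      by (simp add: when_def basic_coeff_eq[OF assms(1)])
  qed
  then show "basic_function n v \<pi> g =
      Sum_any (\<lambda>\<mu>. Polynomial.monom
          (of_real (?q powr (- ((real n - 1) / 2) * real_of_int (cochar_det \<mu>))) * ?D \<mu>)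
          (nat (cochar_det \<mu>))
        when \<mu> \<in> Lam n)"
    unfolding basic_function_def by presburger
qed

end
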